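(* Let $\mathbf M = \langle Q \cup \Sigma \cup \{0\}; \cdot \rangle$ be a finite automatic algebra and let $m > 1$ be an integer. Assume that \begin{itemize} \item[(a)] each $a \in \Sigma$ acts as a permutation $\rho_a$ of $Q$, \item[(b)] the permutations in $\{\rho_a \mid a \in \Sigma\}$ commute, \item[(c)] there are $b,c \in \Sigma$ such that the permutation $\rho_b(\rho_c)^{-1}$ of $Q$ has order $m$, \item[(d)] for each component $C$ of $\mathbf M$, there is no non-trivial subgroup $H$ of the symmetric group $S_C$ such that $|H|$ divides $m$ and the set $\{\rho_a {\upharpoonright}_C \mid a \in \Sigma\}$ contains a coset of $H$. \end{itemize} Then $\mathbf M$ is non-dualizable.
   Context: **Automatic algebras.** An automatic algebra is an algebra with a single binary operation $\mathbf M = \langle Q \cup \Sigma \cup \{0\}; \cdot\rangle$, where $Q$ (states) and $\Sigma$ (letters) are disjoint sets and $0 \notin Q\cup\Sigma$, that encodes a partial (deterministic) automaton: each letter $a \in \Sigma$ acts as a partial map $Q \to Q$; for $q,r\in Q$ and $a \in \Sigma$ we have $q\cdot a = r$ iff $a$ sends $q$ to $r$; all other products are $0$. A component of $\mathbf M$ is a connected component $C\subseteq Q$ of the graph on $Q$ in which $q\sim r$ iff $qa=r$ or $ra=q$ for some $a\in\Sigma$. **Dualizability.** Let $\mathbf M$ be a finite algebra with universe $M$. A $k$-ary relation on $M$ ($k\ge 1$) is compatible with $\mathbf M$ if it is a subuniverse of $\mathbf M^k$. For $\mathbf A \in \mathbb{ISP}(\mathbf M)$ (isomorphic copies of subalgebras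 of powers of $\mathbf M$), view $\hom(\mathbf A,\mathbf M)\subseteq M^A$ with the subspace topology of the product topology ($M$ discrete), and with relations on $M$ interpreted pointwise. A map $f\colon \hom(\mathbf A,\mathbf M)\to M$ is an evaluation if there is $a\in A$ with $f(x)=x(a)$ for all $x$. The algebra $\mathbf M$ is dualizable if, for every $\mathbf A\in\mathbb{ISP}(\mathbf M)$, every continuous map $f\colon\hom(\mathbf A,\mathbf M)\to M$ that preserves all finitary compatible relations on $\mathbf M$ is an evaluation; otherwise it is non-dualizable. *)

theory Defs
  imports
    "HOL-Analysis.Function_Topology"
    "HOL-Algebra.Bij"
    "HOL-Algebra.Coset"
    "HOL-Algebra.Multiplicative_Group"
begin

section \<open>Algebras with one binary operation\<close>

record 'a magma = "'a partial_object" +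
  mul :: "'a \<Rightarrow> 'a \<Rightarrow> 'a" (infixl "\<cdot>\<index>" 70)

definition is_algebra :: "'a magma \<Rightarrow> bool" where
  "is_algebra A \<longleftrightarrow>
     carrier A \<noteq> {} \<and> (\<forall>x\<in>carrier A. \<forall>y\<in>carrier A. x \<cdot>\<^bsub>A\<^esub> y \<in> carrier A)"

definition subuniverse :: "'a set \<Rightarrow> 'a magma \<Rightarrow> bool" where
  "subuniverse B A \<longleftrightarrow> B \<subseteq> carrier A \<and> (\<forall>x\<in>B. \<forall>y\<in>B. x \<cdot>\<^bsub>A\<^esub> y \<in> B)"

definition direct_power :: "'a magma \<Rightarrow> 'i set \<Rightarrow> ('i \<Rightarrow> 'a) magma" where
  "direct_power M I = \<lparr>carrier = I \<rightarrow>\<^sub>E carrier M, mul = (\<lambda>x y. \<lambda>i\<in>I. x i \<cdot>\<^bsub>M\<^esub> y i)\<rparr>"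

text \<open>Homomorphisms are extensional functions, so that equality in \<open>Hom A M\<close> is
  equality of maps on the universe of \<open>A\<close>.\<close>

definition Hom :: "'b magma \<Rightarrow> 'a magma \<Rightarrow> ('b \<Rightarrow> 'a) set" where
  "Hom A M = {x \<in> carrier A \<rightarrow>\<^sub>E carrier M.
     \<forall>a\<in>carrier A. \<forall>b\<in>carrier A. x (a \<cdot>\<^bsub>A\<^esub> b) = x a \<cdot>\<^bsub>M\<^esub> x b}"

definition isomorphism :: "('b \<Rightarrow> 'c) \<Rightarrow> 'b magma \<Rightarrow> 'c magma \<Rightarrow> bool" where
  "isomorphism h A B \<longleftrightarrow> bij_betw h (carrier A) (carrier B) \<and>
     (\<forall>a\<in>carrier A. \<forall>b\<in>carrier A. h (a \<cdot>\<^bsub>A\<^esub> b) = h a \<cdot>\<^bsub>B\<^esub> h b)"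

text \<open>The class of isomorphic copies of subalgebras of powers of \<open>M\<close>.  The index set
  of the power is taken from the type \<^typ>\<open>'b \<Rightarrow> 'a\<close>; this is no restriction, as
  \<open>in_ISP_if_embeds\<close> below shows for index sets of any type (the coordinates of an
  embedding of \<open>A\<close> are homomorphisms, so \<open>Hom A M\<close> can always serve as index set).\<close>

definition in_ISP :: "'a magma \<Rightarrow> 'b magma \<Rightarrow> bool" where
  "in_ISP M A \<longleftrightarrow> is_algebra A \<and>
     (\<exists>(I :: ('b \<Rightarrow> 'a) set) B h.
        subuniverse B (direct_power M I) \<and> isomorphism h A ((direct_power M I)\<lparr>carrier := B\<rparr>))"


section \<open>Dualizability\<close>

text \<open>A \<open>k\<close>-tuple is an extensional function on \<open>{..<k}\<close>.  The empty set counts as a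
  subuniverse here; algebras being non-empty, every map preserves the empty relation.\<close>

definition compatible_relation :: "'a magma \<Rightarrow> nat \<Rightarrow> (nat \<Rightarrow> 'a) set \<Rightarrow> bool" where
  "compatible_relation M k R \<longleftrightarrow> k \<ge> 1 \<and> subuniverse R (direct_power M {..<k})"

definition preserves_relation ::
  "'a magma \<Rightarrow> 'b magma \<Rightarrow> (('b \<Rightarrow> 'a) \<Rightarrow> 'a) \<Rightarrow> nat \<Rightarrow> (nat \<Rightarrow> 'a) set \<Rightarrow> bool" where
  "preserves_relation M A f k R \<longleftrightarrow>
     (\<forall>x \<in> {..<k} \<rightarrow> Hom A M.
        (\<forall>a\<in>carrier A. (\<lambda>i\<in>{..<k}. x i a) \<in> R) \<longrightarrow> (\<lambda>i\<in>{..<k}. f (x i)) \<in> R)"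

definition Hom_topology :: "'b magma \<Rightarrow> 'a magma \<Rightarrow> ('b \<Rightarrow> 'a) topology" where
  "Hom_topology A M =
     subtopology (product_topology (\<lambda>_. discrete_topology (carrier M)) (carrier A)) (Hom A M)"

definition is_evaluation :: "'a magma \<Rightarrow> 'b magma \<Rightarrow> (('b \<Rightarrow> 'a) \<Rightarrow> 'a) \<Rightarrow> bool" where
  "is_evaluation M A f \<longleftrightarrow> (\<exists>a\<in>carrier A. \<forall>x\<in>Hom A M. f x = x a)"

definition dualizes :: "'a magma \<Rightarrow> 'b magma \<Rightarrow> bool" where
  "dualizes M A \<longleftrightarrow>
     (\<forall>f. continuous_map (Hom_topology A M) (discrete_topology (carrier M)) f \<and>
          (\<forall>k R. compatible_relation M k R \<longrightarrow> preserves_relation M A f k R)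
        \<longrightarrow> is_evaluation M A f)"

text \<open>HOL cannot quantify over all types inside a definition, so the definition of
  dualizability ranges over the algebras in the class that live on a set of natural
  numbers, i.e. (up to isomorphism) over the countable ones.  For finite \<open>M\<close> this
  is equivalent to quantifying over algebras of every type and cardinality: that is
  the theorem \<open>dualizable_imp_dualizes\<close> below.\<close>

definition dualizable :: "'a magma \<Rightarrow> bool" where
  "dualizable M \<longleftrightarrow> (\<forall>A :: nat magma. in_ISP M A \<longrightarrow> dualizes M A)"


section \<open>Automatic algebras\<close>

text \<open>\<open>q \<cdot> a = z\<close> with \<open>q \<in> Q\<close>, \<open>a \<in> L\<close> encodes that the partial map of the letter \<open>a\<close>
  is undefined at the state \<open>q\<close>.\<close>

definition automatic_algebra :: "'a magma \<Rightarrow> 'a set \<Rightarrow> 'a set \<Rightarrow> 'a \<Rightarrow> bool" where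
  "automatic_algebra M Q L z \<longleftrightarrow>
     carrier M = Q \<union> L \<union> {z} \<and> Q \<inter> L = {} \<and> z \<notin> Q \<union> L \<and>
     (\<forall>q\<in>Q. \<forall>a\<in>L. q \<cdot>\<^bsub>M\<^esub> a \<in> Q \<union> {z}) \<and>
     (\<forall>x\<in>carrier M. \<forall>y\<in>carrier M. \<not> (x \<in> Q \<and> y \<in> L) \<longrightarrow> x \<cdot>\<^bsub>M\<^esub> y = z)"

definition component_graph :: "'a magma \<Rightarrow> 'a set \<Rightarrow> 'a set \<Rightarrow> ('a \<times> 'a) set" where
  "component_graph M Q L =
     {(q, r). q \<in> Q \<and> r \<in> Q \<and> (\<exists>a\<in>L. q \<cdot>\<^bsub>M\<^esub> a = r \<or> r \<cdot>\<^bsub>M\<^esub> a = q)}"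

definition automaton_components :: "'a magma \<Rightarrow> 'a set \<Rightarrow> 'a set \<Rightarrow> 'a set set" where
  "automaton_components M Q L = Q // (component_graph M Q L)\<^sup>*"

text \<open>The restriction to \<open>C\<close> of the action of the letter \<open>a\<close>, extensional so that it can be
  an element of \<^term>\<open>BijGroup C\<close>; the full action is the case \<open>C = Q\<close>.\<close>

definition action :: "'a magma \<Rightarrow> 'a set \<Rightarrow> 'a \<Rightarrow> 'a \<Rightarrow> 'a" where
  "action M C a = (\<lambda>q\<in>C. q \<cdot>\<^bsub>M\<^esub> a)"


section \<open>Countable algebras suffice\<close>

lemma HomD:
  assumes "x \<in> Hom A M"
  shows "x \<in> carrier A \<rightarrow>\<^sub>E carrier M"
    and "\<And>a. a \<in> carrier A \<Longrightarrow> x a \<in> carrier M"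
    and "\<And>a b. a \<in> carrier A \<Longrightarrow> b \<in> carrier A \<Longrightarrow> x (a \<cdot>\<^bsub>A\<^esub> b) = x a \<cdot>\<^bsub>M\<^esub> x b"
  using assms by (auto simp: Hom_def)

lemma embeds_imp_separated:
  fixes I :: "'i set"
  assumes alg: "is_algebra A" and B: "subuniverse B (direct_power M I)"
    and h: "isomorphism h A ((direct_power M I)\<lparr>carrier := B\<rparr>)"
    and ab: "a \<in> carrier A" "b \<in> carrier A" "a \<noteq> b"
  shows "\<exists>x\<in>Hom A M. x a \<noteq> x b"
proof -
  have bij: "bij_betw h (carrier A) B"
    and mul: "\<And>c d. c \<in> carrier A \<Longrightarrow> d \<in> carrier A \<Longrightarrow>
                h (c \<cdot>\<^bsub>A\<^esub> d) = (\<lambda>i\<in>I. h c i \<cdot>\<^bsub>M\<^esub> h d i)"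
    using h by (auto simp: isomorphism_def direct_power_def)
  have sub: "B \<subseteq> I \<rightarrow>\<^sub>E carrier M" using B by (auto simp: subuniverse_def direct_power_def)
  have hP: "h c \<in> I \<rightarrow>\<^sub>E carrier M" if "c \<in> carrier A" for c
    using bij sub that by (auto simp: bij_betw_def)
  have "h a \<noteq> h b" using bij ab by (auto simp: bij_betw_def inj_on_def)
  then obtain i where i: "i \<in> I" "h a i \<noteq> h b i"
    using hP[OF ab(1)] hP[OF ab(2)] by (meson PiE_ext)
  have "(\<lambda>c\<in>carrier A. h c i) \<in> Hom A M"
    using alg hP i(1) mul by (auto simp: Hom_def is_algebra_def PiE_mem)
  then show ?thesis using i ab by (intro bexI) auto
qed

lemma in_ISP_iff_separated:
  fixes M :: "'a magma" and A :: "'b magma"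
  shows "in_ISP M A \<longleftrightarrow> is_algebra A \<and>
     (\<forall>a\<in>carrier A. \<forall>b\<in>carrier A. a \<noteq> b \<longrightarrow> (\<exists>x\<in>Hom A M. x a \<noteq> x b))"
proof -
  have separated_imp_embeds:
    "\<exists>(I :: ('b \<Rightarrow> 'a) set) B h.
       subuniverse B (direct_power M I) \<and> isomorphism h A ((direct_power M I)\<lparr>carrier := B\<rparr>)"
    if alg: "is_algebra A"
      and sep: "\<forall>a\<in>carrier A. \<forall>b\<in>carrier A. a \<noteq> b \<longrightarrow> (\<exists>x\<in>Hom A M. x a \<noteq> x b)"
  proof -
    define h where "h = (\<lambda>a. \<lambda>x\<in>Hom A M. x a)"
    have mul: "h (a \<cdot>\<^bsub>A\<^esub> b) = (\<lambda>i\<in>Hom A M. h a i \<cdot>\<^bsub>M\<^esub> h b i)"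
      if "a \<in> carrier A" "b \<in> carrier A" for a b
      using that by (auto simp: h_def HomD(3) fun_eq_iff)
    have "inj_on h (carrier A)"
      using sep by (auto simp: inj_on_def h_def fun_eq_iff)
    moreover have "h ` carrier A \<subseteq> Hom A M \<rightarrow>\<^sub>E carrier M"
      by (auto simp: h_def HomD(2))
    moreover have "(\<lambda>i\<in>Hom A M. h a i \<cdot>\<^bsub>M\<^esub> h b i) \<in> h ` carrier A"
      if "a \<in> carrier A" "b \<in> carrier A" for a b
      using that alg by (auto simp flip: mul simp: is_algebra_def)
    ultimately have "subuniverse (h ` carrier A) (direct_power M (Hom A M))"
      "isomorphism h A ((direct_power M (Hom A M))\<lparr>carrier := h ` carrier A\<rparr>)"
      by (auto simp: subuniverse_def isomorphism_def direct_power_def mul bij_betw_def)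
    then show ?thesis by blast
  qed
  show ?thesis
  proof
    assume "in_ISP M A"
    then obtain I :: "('b \<Rightarrow> 'a) set" and B h where alg: "is_algebra A"
      and "subuniverse B (direct_power M I)"
        "isomorphism h A ((direct_power M I)\<lparr>carrier := B\<rparr>)"
      unfolding in_ISP_def by (elim conjE exE)
    from embeds_imp_separated[OF this] alg
    show "is_algebra A \<and>
      (\<forall>a\<in>carrier A. \<forall>b\<in>carrier A. a \<noteq> b \<longrightarrow> (\<exists>x\<in>Hom A M. x a \<noteq> x b))" by simp
  next
    assume "is_algebra A \<and>
      (\<forall>a\<in>carrier A. \<forall>b\<in>carrier A. a \<noteq> b \<longrightarrow> (\<exists>x\<in>Hom A M. x a \<noteq> x b))"
    then show "in_ISP M A"
      unfolding in_ISP_def by (elim conjE, intro conjI separated_imp_embeds)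
  qed
qed

lemma in_ISP_if_embeds:
  fixes I :: "'i set"
  assumes "is_algebra A" and "subuniverse B (direct_power M I)"
    and "isomorphism h A ((direct_power M I)\<lparr>carrier := B\<rparr>)"
  shows "in_ISP M A"
  unfolding in_ISP_iff_separated using assms(1) embeds_imp_separated[OF assms] by simp

lemma cylinder_open:
  assumes "finite F" "F \<subseteq> J" "x \<in> J \<rightarrow>\<^sub>E D"
  shows "openin (product_topology (\<lambda>_. discrete_topology D) J)
           {y \<in> J \<rightarrow>\<^sub>E D. \<forall>j\<in>F. y j = x j}"
proof -
  have "{y \<in> J \<rightarrow>\<^sub>E D. \<forall>j\<in>F. y j = x j} = PiE J (\<lambda>j. if j \<in> F then {x j} else D)"
  proof (intro subset_antisym subsetI)
    fix y assume "y \<in> PiE J (\<lambda>j. if j \<in> F then {x j} else D)"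
    then have *: "\<And>j. j \<in> J \<Longrightarrow> y j \<in> (if j \<in> F then {x j} else D)" and "y \<in> extensional J"
      by (auto simp: PiE_iff)
    then show "y \<in> {y \<in> J \<rightarrow>\<^sub>E D. \<forall>j\<in>F. y j = x j}"
      using assms *
      by (auto simp: PiE_iff subset_iff split: if_splits) (metis singletonD)+
  qed (auto simp: PiE_iff)
  moreover have "finite {i \<in> J. (if i \<in> F then {x i} else D) \<noteq> topspace (discrete_topology D)}"
    by (rule finite_subset[OF _ assms(1)]) auto
  ultimately show ?thesis using assms by (auto simp: openin_PiE_gen)
qed

lemma finitely_determined_compactness:
  assumes D: "finite D"
    and det: "\<And>i. i \<in> I \<Longrightarrow> \<exists>F. finite F \<and> F \<subseteq> J \<and>
        (\<forall>x \<in> J \<rightarrow>\<^sub>E D. \<forall>y \<in> J \<rightarrow>\<^sub>E D. (\<forall>j\<in>F. x j = y j) \<longrightarrow> P i x \<longrightarrow> P i y)"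
    and none: "\<And>x. x \<in> J \<rightarrow>\<^sub>E D \<Longrightarrow> \<exists>i\<in>I. P i x"
  shows "\<exists>I0. finite I0 \<and> I0 \<subseteq> I \<and> (\<forall>x \<in> J \<rightarrow>\<^sub>E D. \<exists>i\<in>I0. P i x)"
proof -
  let ?T = "product_topology (\<lambda>_. discrete_topology D) J"
  let ?U = "\<lambda>i. {x \<in> J \<rightarrow>\<^sub>E D. P i x}"
  have "compact_space ?T"
    using D by (simp add: compact_space_product_topology compact_space_discrete_topology)
  then have comp: "compactin ?T (J \<rightarrow>\<^sub>E D)"
    by (simp add: compact_space_def)
  have op: "openin ?T (?U i)" if i: "i \<in> I" for i
  proof -
    obtain F where F: "finite F" "F \<subseteq> J"
      "\<forall>x \<in> J \<rightarrow>\<^sub>E D. \<forall>y \<in> J \<rightarrow>\<^sub>E D. (\<forall>j\<in>F. x j = y j) \<longrightarrow> P i x \<longrightarrow> P i y"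
      using det[OF i] by (elim exE conjE)
    have "?U i = (\<Union>x\<in>?U i. {y \<in> J \<rightarrow>\<^sub>E D. \<forall>j\<in>F. y j = x j})"
    proof (intro subset_antisym subsetI)
      fix y assume "y \<in> (\<Union>x\<in>?U i. {y \<in> J \<rightarrow>\<^sub>E D. \<forall>j\<in>F. y j = x j})"
      then obtain x where "x \<in> J \<rightarrow>\<^sub>E D" "P i x" "y \<in> J \<rightarrow>\<^sub>E D" "\<forall>j\<in>F. x j = y j" by auto
      then show "y \<in> ?U i" using F(3) by blast
    qed auto
    moreover have "openin ?T (\<Union>x\<in>?U i. {y \<in> J \<rightarrow>\<^sub>E D. \<forall>j\<in>F. y j = x j})"
      using cylinder_open[OF F(1,2)] by (intro openin_Union) auto
    ultimately show ?thesis by simp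
  qed
  have "\<forall>U\<in>?U ` I. openin ?T U" using op by blast
  moreover have "(J \<rightarrow>\<^sub>E D) \<subseteq> \<Union>(?U ` I)" using none by auto
  ultimately have "\<exists>\<F>. finite \<F> \<and> \<F> \<subseteq> ?U ` I \<and> (J \<rightarrow>\<^sub>E D) \<subseteq> \<Union>\<F>"
    using comp unfolding compactin_def by meson
  then obtain \<F> where "finite \<F>" "\<F> \<subseteq> ?U ` I" and cov: "(J \<rightarrow>\<^sub>E D) \<subseteq> \<Union>\<F>" by blast
  then obtain I0 where "I0 \<subseteq> I" "finite I0" "\<F> = ?U ` I0"
    by (meson finite_subset_image)
  with cov show ?thesis by (intro exI[of _ I0]) blast
qed

lemma continuous_iff_finitely_determined:
  assumes fin: "finite (carrier M)" and alg: "is_algebra A"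
  shows "continuous_map (Hom_topology A M) (discrete_topology (carrier M)) f \<longleftrightarrow>
     f \<in> Hom A M \<rightarrow> carrier M \<and>
     (\<exists>F. finite F \<and> F \<subseteq> carrier A \<and>
        (\<forall>x\<in>Hom A M. \<forall>y\<in>Hom A M. (\<forall>a\<in>F. x a = y a) \<longrightarrow> f x = f y))" (is "?L \<longleftrightarrow> ?R")
proof
  let ?T = "product_topology (\<lambda>_. discrete_topology (carrier M)) (carrier A)"
  let ?P = "carrier A \<rightarrow>\<^sub>E carrier M"
  have sub: "Hom A M \<subseteq> ?P" by (auto simp: Hom_def)
  have top: "topspace (Hom_topology A M) = Hom A M"
    using sub by (auto simp: Hom_topology_def)
  {
    assume L: ?L
    have f: "f \<in> Hom A M \<rightarrow> carrier M"
      using L top by (auto simp: continuous_map_def)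
    have "\<exists>F. finite F \<and> F \<subseteq> carrier A \<and> (\<forall>y\<in>Hom A M. (\<forall>a\<in>F. x a = y a) \<longrightarrow> f y = f x)"
      if x: "x \<in> Hom A M" for x
    proof -
      have "openin (Hom_topology A M) {y \<in> topspace (Hom_topology A M). f y \<in> {f x}}"
        using L f x by (intro openin_continuous_map_preimage) auto
      then obtain U where U: "openin ?T U" "{y \<in> Hom A M. f y = f x} = U \<inter> Hom A M"
        unfolding top by (auto simp: Hom_topology_def openin_subtopology)
      have "x \<in> U" using U x by blast
      then obtain X where X: "x \<in> (\<Pi>\<^sub>E i\<in>carrier A. X i)"
        "finite {i. X i \<noteq> topspace (discrete_topology (carrier M))}"
        "(\<Pi>\<^sub>E i\<in>carrier A. X i) \<subseteq> U"
        using product_topology_open_contains_basis[OF U(1)] by blast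
      let ?F = "{i. X i \<noteq> topspace (discrete_topology (carrier M))} \<inter> carrier A"
      have "f y = f x" if y: "y \<in> Hom A M" "\<forall>a\<in>?F. x a = y a" for y
      proof -
        have "y \<in> (\<Pi>\<^sub>E i\<in>carrier A. X i)"
        proof (rule PiE_I)
          fix i assume i: "i \<in> carrier A"
          show "y i \<in> X i"
          proof (cases "X i = carrier M")
            case True then show ?thesis using HomD(2)[OF y(1) i] by simp
          next
            case False
            then have "x i = y i" using y(2) i by auto
            then show ?thesis using X(1) i by (metis PiE_mem)
          qed
        next
          fix i assume "i \<notin> carrier A"
          then show "y i = undefined" using HomD(1)[OF y(1)] by (meson PiE_arb)
        qed
        then show ?thesis using X(3) U(2) y(1) by blast
      qed
      then show ?thesis using X(2) by (intro exI[of _ ?F]) auto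
    qed
    then obtain G where G: "\<And>x. x \<in> Hom A M \<Longrightarrow> finite (G x) \<and> G x \<subseteq> carrier A \<and>
        (\<forall>y\<in>Hom A M. (\<forall>a\<in>G x. x a = y a) \<longrightarrow> f y = f x)"
      by metis
    show ?R
    proof (cases "Hom A M = {}")
      case True then show ?thesis by auto
    next
      case False
      let ?I = "carrier A \<times> carrier A \<times> Hom A M"
      let ?Q = "\<lambda>(a, b, x) y. y (a \<cdot>\<^bsub>A\<^esub> b) \<noteq> y a \<cdot>\<^bsub>M\<^esub> y b \<or> (\<forall>c\<in>G x. x c = y c)"
      have "\<exists>I0. finite I0 \<and> I0 \<subseteq> ?I \<and> (\<forall>y\<in>?P. \<exists>i\<in>I0. ?Q i y)"
      proof (rule finitely_determined_compactness[OF fin])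
        fix i assume "i \<in> ?I"
        then obtain a b x where i: "i = (a, b, x)"
          and abx: "a \<in> carrier A" "b \<in> carrier A" "x \<in> Hom A M" by auto
        show "\<exists>F. finite F \<and> F \<subseteq> carrier A \<and>
          (\<forall>x\<in>?P. \<forall>y\<in>?P. (\<forall>j\<in>F. x j = y j) \<longrightarrow> ?Q i x \<longrightarrow> ?Q i y)"
          using abx G[OF abx(3)] alg
          by (intro exI[of _ "{a, b, a \<cdot>\<^bsub>A\<^esub> b} \<union> G x"]) (auto simp: i is_algebra_def)
      next
        fix y assume y: "y \<in> ?P"
        obtain a0 where a0: "a0 \<in> carrier A" using alg by (auto simp: is_algebra_def)
        show "\<exists>i\<in>?I. ?Q i y"
        proof (cases "y \<in> Hom A M")
          case True
          then show ?thesis using a0 by (intro bexI[of _ "(a0, a0, y)"]) auto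
        next
          case no: False
          then obtain a b where "a \<in> carrier A" "b \<in> carrier A"
            "y (a \<cdot>\<^bsub>A\<^esub> b) \<noteq> y a \<cdot>\<^bsub>M\<^esub> y b"
            using y by (auto simp: Hom_def)
          moreover obtain x where "x \<in> Hom A M" using False by blast
          ultimately show ?thesis by (intro bexI[of _ "(a, b, x)"]) auto
        qed
      qed
      then obtain I0 where I0: "finite I0" "I0 \<subseteq> ?I" "\<And>y. y \<in> ?P \<Longrightarrow> \<exists>i\<in>I0. ?Q i y"
        by blast
      let ?F = "\<Union>i\<in>I0. G (snd (snd i))"
      have "f y = f y'" if y: "y \<in> Hom A M" "y' \<in> Hom A M" "\<forall>a\<in>?F. y a = y' a" for y y'
      proof -
        have "y \<in> ?P" using sub y(1) by blast
        then obtain j where "j \<in> I0" "?Q j y" using I0(3) by blast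
        then obtain a b x where i: "(a, b, x) \<in> I0" "?Q (a, b, x) y"
          by (cases j) blast
        have abx: "a \<in> carrier A" "b \<in> carrier A" "x \<in> Hom A M" using i(1) I0(2) by auto
        have 1: "\<forall>c\<in>G x. x c = y c"
          using i(2) HomD(3)[OF y(1) abx(1,2)] by simp
        moreover have "\<forall>c\<in>G x. y c = y' c" using y(3) i(1) by fastforce
        ultimately have 2: "\<forall>c\<in>G x. x c = y' c" by simp
        show ?thesis using G[OF abx(3)] 1 2 y by metis
      qed
      moreover have "finite ?F" "?F \<subseteq> carrier A" using I0(1,2) G by force+
      ultimately show ?thesis using f by blast
    qed
  next
    assume R: ?R
    then obtain F where F: "finite F" "F \<subseteq> carrier A"
      "\<And>x y. x \<in> Hom A M \<Longrightarrow> y \<in> Hom A M \<Longrightarrow> (\<forall>a\<in>F. x a = y a) \<Longrightarrow> f x = f y"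
      by blast
    show ?L
      unfolding continuous_map_def top
    proof (intro conjI allI impI)
      show "f \<in> Hom A M \<rightarrow> topspace (discrete_topology (carrier M))" using R by simp
      fix V
      let ?W = "{x \<in> Hom A M. f x \<in> V}"
      let ?U = "\<Union>x\<in>?W. {y \<in> ?P. \<forall>j\<in>F. y j = x j}"
      have "?U \<inter> Hom A M \<subseteq> ?W" 
      proof
        fix y assume "y \<in> ?U \<inter> Hom A M"
        then obtain x where "x \<in> ?W" "\<forall>j\<in>F. x j = y j" "y \<in> Hom A M" by auto
        then show "y \<in> ?W" using F(3)[of x y] by auto
      qed
      moreover have "?W \<subseteq> ?U \<inter> Hom A M" using sub by blast
      ultimately have "?W = ?U \<inter> Hom A M" by (rule subset_antisym[rotated])
      moreover have "openin ?T ?U"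
        using sub by (auto intro!: openin_Union cylinder_open[OF F(1,2)])
      ultimately show "openin (Hom_topology A M) ?W"
        unfolding Hom_topology_def openin_subtopology by blast
    qed
  }
qed

lemma subalgebra_in_ISP:
  assumes A: "in_ISP M A" and B: "subuniverse B A" and ne: "B \<noteq> {}"
  shows "in_ISP M (A\<lparr>carrier := B\<rparr>)"
proof -
  have BA: "B \<subseteq> carrier A" and Bc: "\<And>a b. a \<in> B \<Longrightarrow> b \<in> B \<Longrightarrow> a \<cdot>\<^bsub>A\<^esub> b \<in> B"
    using B by (auto simp: subuniverse_def)
  have "restrict x B \<in> Hom (A\<lparr>carrier := B\<rparr>) M" if "x \<in> Hom A M" for x
    using that BA Bc by (auto simp: Hom_def subset_iff PiE_mem)
  moreover have "\<exists>x\<in>Hom A M. x a \<noteq> x b" if "a \<in> B" "b \<in> B" "a \<noteq> b" for a b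
    using A that BA by (auto simp: in_ISP_iff_separated subset_iff)
  ultimately show ?thesis
    using ne Bc unfolding in_ISP_iff_separated is_algebra_def
    by (auto simp: Bex_def) (metis restrict_apply')
qed

lemma isomorphism_inverse:
  assumes h: "isomorphism h A B" and alg: "is_algebra A" "is_algebra B"
  shows "isomorphism (inv_into (carrier A) h) B A"
proof -
  have bij: "bij_betw h (carrier A) (carrier B)"
    and mul: "\<And>a b. a \<in> carrier A \<Longrightarrow> b \<in> carrier A \<Longrightarrow> h (a \<cdot>\<^bsub>A\<^esub> b) = h a \<cdot>\<^bsub>B\<^esub> h b"
    using h by (auto simp: isomorphism_def)
  let ?g = "inv_into (carrier A) h"
  have "?g (c \<cdot>\<^bsub>B\<^esub> d) = ?g c \<cdot>\<^bsub>A\<^esub> ?g d" if cd: "c \<in> carrier B" "d \<in> carrier B" for c d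
  proof -
    have g: "?g c \<in> carrier A" "?g d \<in> carrier A" "h (?g c) = c" "h (?g d) = d"
      using cd bij by (auto simp: bij_betw_def inv_into_into f_inv_into_f)
    then have "c \<cdot>\<^bsub>B\<^esub> d = h (?g c \<cdot>\<^bsub>A\<^esub> ?g d)" by (simp add: mul)
    moreover have "?g c \<cdot>\<^bsub>A\<^esub> ?g d \<in> carrier A" using g alg by (auto simp: is_algebra_def)
    ultimately show ?thesis using bij by (simp add: bij_betw_def)
  qed
  then show ?thesis using bij_betw_inv_into[OF bij] by (auto simp: isomorphism_def)
qed

lemma Hom_compose_isomorphism:
  assumes h: "isomorphism h A B" and alg: "is_algebra A" and x: "x \<in> Hom B M"
  shows "(\<lambda>a\<in>carrier A. x (h a)) \<in> Hom A M"
proof -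
  have hB: "h a \<in> carrier B" if "a \<in> carrier A" for a
    using h that by (auto simp: isomorphism_def bij_betw_def)
  show ?thesis
    using h alg hB HomD(2,3)[OF x] by (auto simp: Hom_def isomorphism_def is_algebra_def)
qed

lemma isomorphic_in_ISP:
  assumes h: "isomorphism h A B" and alg: "is_algebra A" and B: "in_ISP M B"
  shows "in_ISP M A"
proof -
  have "\<exists>x\<in>Hom A M. x a \<noteq> x b"
    if ab: "a \<in> carrier A" "b \<in> carrier A" "a \<noteq> b" for a b
  proof -
    have "h a \<in> carrier B" "h b \<in> carrier B" "h a \<noteq> h b"
      using h ab by (auto simp: isomorphism_def bij_betw_def inj_on_def)
    then obtain x where "x \<in> Hom B M" "x (h a) \<noteq> x (h b)"
      using B by (auto simp: in_ISP_iff_separated)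
    then show ?thesis using Hom_compose_isomorphism[OF h alg] ab
      by (intro bexI[of _ "\<lambda>a\<in>carrier A. x (h a)"]) auto
  qed
  with alg show ?thesis by (auto simp: in_ISP_iff_separated)
qed

lemma isomorphic_dualizes:
  assumes fin: "finite (carrier M)" and h: "isomorphism h A B"
    and alg: "is_algebra A" "is_algebra B" and B: "dualizes M B"
  shows "dualizes M A"
  unfolding dualizes_def
proof (intro allI impI, elim conjE)
  fix f
  assume cont: "continuous_map (Hom_topology A M) (discrete_topology (carrier M)) f"
    and pres: "\<forall>k R. compatible_relation M k R \<longrightarrow> preserves_relation M A f k R"
  let ?g = "inv_into (carrier A) h"
  let ?pull = "\<lambda>x. \<lambda>a\<in>carrier A. x (h a)"
  have bij: "bij_betw h (carrier A) (carrier B)" using h by (auto simp: isomorphism_def)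
  have hB: "h a \<in> carrier B" if "a \<in> carrier A" for a
    using bij that by (auto simp: bij_betw_def)
  have gh: "?g (h a) = a" if "a \<in> carrier A" for a
    using bij that by (auto simp: bij_betw_def)
  have hg: "h (?g b) = b" "?g b \<in> carrier A" if "b \<in> carrier B" for b
    using bij that by (auto simp: bij_betw_def f_inv_into_f inv_into_into)
  have pull: "?pull x \<in> Hom A M" if "x \<in> Hom B M" for x
    by (rule Hom_compose_isomorphism[OF h alg(1) that])
  obtain F where F: "finite F" "F \<subseteq> carrier A"
    "\<And>x y. x \<in> Hom A M \<Longrightarrow> y \<in> Hom A M \<Longrightarrow> (\<forall>a\<in>F. x a = y a) \<Longrightarrow> f x = f y"
    and f: "f \<in> Hom A M \<rightarrow> carrier M"
    using cont unfolding continuous_iff_finitely_determined[OF fin alg(1)] by blast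
  let ?f = "\<lambda>x. f (?pull x)"
  have "continuous_map (Hom_topology B M) (discrete_topology (carrier M)) ?f"
    unfolding continuous_iff_finitely_determined[OF fin alg(2)]
  proof (intro conjI exI[of _ "h ` F"] ballI impI)
    show "?f \<in> Hom B M \<rightarrow> carrier M" using f pull by blast
    show "finite (h ` F)" using F by simp
    show "h ` F \<subseteq> carrier B" using F hB by blast
    fix x y assume "x \<in> Hom B M" "y \<in> Hom B M" "\<forall>a\<in>h ` F. x a = y a"
    then show "?f x = ?f y" using F(2) by (intro F(3) pull) auto
  qed
  moreover have "preserves_relation M B ?f k R" if R: "compatible_relation M k R" for k R
    unfolding preserves_relation_def
  proof (intro ballI impI)
    fix x assume x: "x \<in> {..<k} \<rightarrow> Hom B M"
      and xR: "\<forall>b\<in>carrier B. (\<lambda>i\<in>{..<k}. x i b) \<in> R"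
    have "(\<lambda>i. ?pull (x i)) \<in> {..<k} \<rightarrow> Hom A M" using x pull by blast
    moreover have "\<forall>a\<in>carrier A. (\<lambda>i\<in>{..<k}. ?pull (x i) a) \<in> R"
      using xR hB by (simp cong: restrict_cong)
    ultimately show "(\<lambda>i\<in>{..<k}. ?f (x i)) \<in> R"
      using pres[rule_format, OF R] unfolding preserves_relation_def by auto
  qed
  ultimately have "is_evaluation M B ?f" using B unfolding dualizes_def by blast
  then obtain b where b: "b \<in> carrier B" "\<And>x. x \<in> Hom B M \<Longrightarrow> ?f x = x b"
    by (auto simp: is_evaluation_def)
  have "f y = y (?g b)" if y: "y \<in> Hom A M" for y
  proof -
    let ?x = "\<lambda>b\<in>carrier B. y (?g b)"
    have x: "?x \<in> Hom B M"
      by (rule Hom_compose_isomorphism[OF isomorphism_inverse[OF h alg] alg(2) y])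
    have "?pull ?x a = y a" for a
      using PiE_arb[OF HomD(1)[OF y]] by (cases "a \<in> carrier A") (simp_all add: hB gh)
    then have "?pull ?x = y" by blast
    then show ?thesis using b(2)[OF x] b(1) by simp
  qed
  then show "is_evaluation M A f" using hg(2)[OF b(1)] by (auto simp: is_evaluation_def)
qed

lemma countable_subuniverse:
  assumes alg: "is_algebra A" and S: "countable S" "S \<subseteq> carrier A"
  shows "\<exists>B. subuniverse B A \<and> countable B \<and> S \<subseteq> B"
proof -
  define step where "step = (\<lambda>X. X \<union> (\<lambda>(a, b). a \<cdot>\<^bsub>A\<^esub> b) ` (X \<times> X))"
  define X where "X = (\<lambda>n. (step ^^ n) S)"
  have X0: "X 0 = S" and XS: "X (Suc n) = step (X n)" for n by (simp_all add: X_def)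
  have cnt: "countable (X n)" for n
    by (induction n) (auto simp: X0 XS step_def S)
  have sub: "X n \<subseteq> carrier A" for n
    using alg S by (induction n) (auto simp: X0 XS step_def is_algebra_def)
  have mono: "X m \<subseteq> X n" if "m \<le> n" for m n
    using that by (rule lift_Suc_mono_le[rotated]) (auto simp: XS step_def)
  have "a \<cdot>\<^bsub>A\<^esub> b \<in> (\<Union>n. X n)" if "a \<in> X m" "b \<in> X n" for a b m n
  proof -
    have "a \<in> X (max m n)" "b \<in> X (max m n)" using that mono by (meson max.cobounded1 max.cobounded2 subsetD)+
    then have "a \<cdot>\<^bsub>A\<^esub> b \<in> X (Suc (max m n))" by (auto simp: XS step_def)
    then show ?thesis by blast
  qed
  moreover have "(\<Union>n. X n) \<subseteq> carrier A" using sub by blast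
  ultimately have "subuniverse (\<Union>n. X n) A" by (auto simp: subuniverse_def)
  moreover have "S \<subseteq> (\<Union>n. X n)" using X0 by blast
  ultimately show ?thesis using cnt by (intro exI[of _ "\<Union>n. X n"]) auto
qed

lemma local_evaluation:
  assumes alg: "is_algebra A" and algM: "is_algebra M" and k: "k \<ge> 1"
    and pres: "\<And>R. compatible_relation M k R \<Longrightarrow> preserves_relation M A f k R"
    and x: "x \<in> {..<k} \<rightarrow> Hom A M"
  shows "\<exists>a\<in>carrier A. \<forall>i<k. f (x i) = x i a"
proof -
  let ?e = "\<lambda>a. \<lambda>i\<in>{..<k}. x i a"
  let ?R = "?e ` carrier A"
  have xH: "x i \<in> Hom A M" if "i < k" for i using x that by blast
  have "?e a \<in> {..<k} \<rightarrow>\<^sub>E carrier M" if "a \<in> carrier A" for a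
    using HomD(2)[OF xH that] by auto
  moreover have "(\<lambda>i\<in>{..<k}. ?e a i \<cdot>\<^bsub>M\<^esub> ?e b i) = ?e (a \<cdot>\<^bsub>A\<^esub> b)"
    if "a \<in> carrier A" "b \<in> carrier A" for a b
    using that by (intro restrict_ext) (simp add: HomD(3)[OF xH])
  moreover have "?e (a \<cdot>\<^bsub>A\<^esub> b) \<in> ?R" if "a \<in> carrier A" "b \<in> carrier A" for a b
    using that alg by (auto simp: is_algebra_def)
  ultimately have "subuniverse ?R (direct_power M {..<k})"
    unfolding subuniverse_def direct_power_def partial_object.simps magma.simps
    by (simp only: ball_simps image_subset_iff) simp
  then have "compatible_relation M k ?R" using k by (simp add: compatible_relation_def)
  then have "(\<lambda>i\<in>{..<k}. f (x i)) \<in> ?R"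
    using pres x unfolding preserves_relation_def by blast
  then obtain a where "a \<in> carrier A" "(\<lambda>i\<in>{..<k}. f (x i)) = ?e a" by blast
  then show ?thesis by (metis lessThan_iff restrict_apply')
qed

theorem dualizable_imp_dualizes:
  fixes M :: "'a magma" and A :: "'b magma"
  assumes fin: "finite (carrier M)" and algM: "is_algebra M"
    and dual: "dualizable M" and ISP: "in_ISP M A"
  shows "dualizes M A"
  unfolding dualizes_def
proof (intro allI impI, elim conjE, rule ccontr)
  fix f
  assume cont: "continuous_map (Hom_topology A M) (discrete_topology (carrier M)) f"
    and pres: "\<forall>k R. compatible_relation M k R \<longrightarrow> preserves_relation M A f k R"
    and noev: "\<not> is_evaluation M A f"
  have alg: "is_algebra A" using ISP by (simp add: in_ISP_def)
  have clA: "a \<cdot>\<^bsub>A\<^esub> b \<in> carrier A" if "a \<in> carrier A" "b \<in> carrier A" for a b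
    using alg that by (auto simp: is_algebra_def)
  let ?P = "carrier A \<rightarrow>\<^sub>E carrier M"
  obtain F where F: "finite F" "F \<subseteq> carrier A"
    "\<And>x y. x \<in> Hom A M \<Longrightarrow> y \<in> Hom A M \<Longrightarrow> (\<forall>a\<in>F. x a = y a) \<Longrightarrow> f x = f y"
    and f: "f \<in> Hom A M \<rightarrow> carrier M"
    using cont unfolding continuous_iff_finitely_determined[OF fin alg] by blast
  obtain m0 where m0: "m0 \<in> carrier M" using algM by (auto simp: is_algebra_def)
  define g where "g = (\<lambda>y. if \<exists>x\<in>Hom A M. \<forall>a\<in>F. x a = y a
    then f (SOME x. x \<in> Hom A M \<and> (\<forall>a\<in>F. x a = y a)) else m0)"
  have g_f: "g y = f x" if "x \<in> Hom A M" "\<forall>a\<in>F. x a = y a" for x y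
  proof -
    let ?x = "SOME x. x \<in> Hom A M \<and> (\<forall>a\<in>F. x a = y a)"
    have "?x \<in> Hom A M \<and> (\<forall>a\<in>F. ?x a = y a)" by (rule someI[of _ x]) (use that in simp)
    then have "f ?x = f x" using that by (intro F(3)) simp_all
    then show ?thesis using that by (auto simp: g_def)
  qed
  have g_det: "g y = g y'" if "\<forall>a\<in>F. y a = y' a" for y y'
  proof -
    have "(\<forall>a\<in>F. x a = y a) \<longleftrightarrow> (\<forall>a\<in>F. x a = y' a)" for x using that by simp
    then show ?thesis by (simp only: g_def)
  qed
  have g_in: "g y \<in> carrier M" for y
  proof (cases "\<exists>x\<in>Hom A M. \<forall>a\<in>F. x a = y a")
    case True then show ?thesis using g_f f by force
  next
    case False
    then show ?thesis unfolding g_def by (subst if_not_P) (use m0 in simp_all)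
  qed
  define loc_ev where "loc_ev = (\<lambda>(k :: nat) H. finite H \<and> H \<subseteq> carrier A \<and>
     (\<forall>y\<in>{..<k} \<rightarrow> ?P. (\<forall>i<k. \<forall>a\<in>H. \<forall>b\<in>H. a \<cdot>\<^bsub>A\<^esub> b \<in> H \<longrightarrow> y i (a \<cdot>\<^bsub>A\<^esub> b) = y i a \<cdot>\<^bsub>M\<^esub> y i b)
        \<longrightarrow> (\<exists>c\<in>H. \<forall>i<k. g (y i) = y i c)))"
  have loc: "\<exists>H. loc_ev k H" if k: "k \<ge> 1" for k :: nat
  proof -
    let ?J = "{..<k} \<times> carrier A"
    let ?row = "\<lambda>y i. \<lambda>a\<in>carrier A. y (i, a)"
    let ?I = "carrier A \<times> carrier A \<times> carrier A"
    let ?Q = "\<lambda>(a, b, c) y. (\<exists>i<k. y (i, a \<cdot>\<^bsub>A\<^esub> b) \<noteq> y (i, a) \<cdot>\<^bsub>M\<^esub> y (i, b)) \<or>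
                (\<forall>i<k. g (?row y i) = y (i, c))"
    have "\<exists>I0. finite I0 \<and> I0 \<subseteq> ?I \<and> (\<forall>y \<in> ?J \<rightarrow>\<^sub>E carrier M. \<exists>i\<in>I0. ?Q i y)"
    proof (rule finitely_determined_compactness[OF fin])
      fix j assume "j \<in> ?I"
      then obtain a b c where j: "j = (a, b, c)"
        and abc: "a \<in> carrier A" "b \<in> carrier A" "c \<in> carrier A" by auto
      let ?G = "{..<k} \<times> ({a, b, a \<cdot>\<^bsub>A\<^esub> b, c} \<union> F)"
      have "?Q j y'" if y: "\<forall>p\<in>?G. y p = y' p" "?Q j y" for y y' :: "nat \<times> 'b \<Rightarrow> 'a"
      proof -
        have "g (?row y i) = g (?row y' i)" if "i < k" for i
          using y(1) that F(2) by (intro g_det) auto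
        then show ?thesis using y by (auto simp: j)
      qed
      moreover have "finite ?G" "?G \<subseteq> ?J" using F abc clA by auto
      ultimately show "\<exists>G. finite G \<and> G \<subseteq> ?J \<and> (\<forall>x \<in> ?J \<rightarrow>\<^sub>E carrier M.
          \<forall>y \<in> ?J \<rightarrow>\<^sub>E carrier M. (\<forall>p\<in>G. x p = y p) \<longrightarrow> ?Q j x \<longrightarrow> ?Q j y)"
        by (intro exI[of _ ?G] conjI ballI impI)
    next
      fix y assume y: "y \<in> ?J \<rightarrow>\<^sub>E carrier M"
      obtain a0 where a0: "a0 \<in> carrier A" using alg by (auto simp: is_algebra_def)
      show "\<exists>j\<in>?I. ?Q j y"
      proof (cases "\<forall>i<k. ?row y i \<in> Hom A M")
        case True
        then have "?row y \<in> {..<k} \<rightarrow> Hom A M" by auto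
        then obtain c where c: "c \<in> carrier A" "\<forall>i<k. f (?row y i) = ?row y i c"
          using local_evaluation[OF alg algM k, of f "?row y"] pres by blast
        have "g (?row y i) = y (i, c)" if "i < k" for i
          using g_f[of "?row y i" "?row y i"] True c that by simp
        then show ?thesis using a0 c by (intro bexI[of _ "(a0, a0, c)"]) auto
      next
        case False
        then obtain i where i: "i < k" "?row y i \<notin> Hom A M" by blast
        have "?row y i \<in> ?P" using y i(1) by (auto simp: PiE_mem)
        then obtain a b where ab: "a \<in> carrier A" "b \<in> carrier A"
          "?row y i (a \<cdot>\<^bsub>A\<^esub> b) \<noteq> ?row y i a \<cdot>\<^bsub>M\<^esub> ?row y i b"
          using i(2) unfolding Hom_def by blast
        then have "y (i, a \<cdot>\<^bsub>A\<^esub> b) \<noteq> y (i, a) \<cdot>\<^bsub>M\<^esub> y (i, b)" using clA by simp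
        then show ?thesis using i ab by (intro bexI[of _ "(a, b, a)"]) auto
      qed
    qed
    then obtain I0 where I0: "finite I0" "I0 \<subseteq> ?I"
      "\<forall>y \<in> ?J \<rightarrow>\<^sub>E carrier M. \<exists>i\<in>I0. ?Q i y" by (elim exE conjE)
    let ?H = "\<Union>(a, b, c)\<in>I0. {a, b, a \<cdot>\<^bsub>A\<^esub> b, c}"
    have "\<exists>c\<in>?H. \<forall>i<k. g (y i) = y i c"
      if y: "y \<in> {..<k} \<rightarrow> ?P"
        and hom: "\<forall>i<k. \<forall>a\<in>?H. \<forall>b\<in>?H. a \<cdot>\<^bsub>A\<^esub> b \<in> ?H \<longrightarrow> y i (a \<cdot>\<^bsub>A\<^esub> b) = y i a \<cdot>\<^bsub>M\<^esub> y i b" for y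
    proof -
      let ?y = "\<lambda>p\<in>?J. y (fst p) (snd p)"
      have yP: "y i \<in> ?P" if "i < k" for i using y that by blast
      have "?y \<in> ?J \<rightarrow>\<^sub>E carrier M" by (auto intro!: PiE_mem[OF yP])
      then have "\<exists>j\<in>I0. ?Q j ?y" by (rule bspec[OF I0(3)])
      then obtain j where "j \<in> I0" "?Q j ?y" by (elim bexE)
      then obtain a b c where abc: "(a, b, c) \<in> I0" "?Q (a, b, c) ?y"
        by (cases j) simp
      have inA: "a \<in> carrier A" "b \<in> carrier A" "c \<in> carrier A" using abc(1) I0(2) by auto
      have inH: "a \<in> ?H" "b \<in> ?H" "a \<cdot>\<^bsub>A\<^esub> b \<in> ?H" "c \<in> ?H" using abc(1) by force+
      have "y i (a \<cdot>\<^bsub>A\<^esub> b) = y i a \<cdot>\<^bsub>M\<^esub> y i b" if "i < k" for i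
        using hom inH that by blast
      then have "\<forall>i<k. g (?row ?y i) = ?y (i, c)"
        using abc(2) inA clA by auto
      moreover have "g (?row ?y i) = g (y i)" if "i < k" for i
        using that F(2) by (intro g_det) auto
      ultimately have "\<forall>i<k. g (y i) = y i c" using inA by simp
      then show ?thesis using inH by blast
    qed
    moreover have "finite ?H" "?H \<subseteq> carrier A" using I0(1,2) clA by auto
    ultimately show ?thesis unfolding loc_ev_def by (intro exI[of _ ?H] conjI ballI impI)
  qed
  then obtain H where "\<And>k. k \<ge> 1 \<Longrightarrow> loc_ev k (H k)" by metis
  note H = this[unfolded loc_ev_def]
  obtain a0 where a0: "a0 \<in> carrier A" using alg by (auto simp: is_algebra_def)
  let ?S = "insert a0 F \<union> (\<Union>k\<in>{1..}. H k)"
  have "countable ?S" using F(1) H by (auto intro: countable_finite)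
  moreover have "?S \<subseteq> carrier A" using F(2) H a0 by auto
  ultimately obtain B where B: "subuniverse B A" "countable B" "?S \<subseteq> B"
    using countable_subuniverse[OF alg] by blast
  have BA: "B \<subseteq> carrier A" and Bc: "\<And>a b. a \<in> B \<Longrightarrow> b \<in> B \<Longrightarrow> a \<cdot>\<^bsub>A\<^esub> b \<in> B"
    using B(1) by (auto simp: subuniverse_def)
  have FB: "F \<subseteq> B" and HB: "\<And>k. k \<ge> 1 \<Longrightarrow> H k \<subseteq> B" and a0B: "a0 \<in> B" using B(3) by auto
  let ?B = "A\<lparr>carrier := B\<rparr>"
  have ISPB: "in_ISP M ?B" using subalgebra_in_ISP[OF ISP B(1)] a0B by blast
  then have algB: "is_algebra ?B" by (simp add: in_ISP_def)
  have "continuous_map (Hom_topology ?B M) (discrete_topology (carrier M)) g"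
    unfolding continuous_iff_finitely_determined[OF fin algB]
    using F(1) FB g_in g_det by (intro conjI exI[of _ F]) auto
  moreover have "preserves_relation M ?B g k R" if R: "compatible_relation M k R" for k R
    unfolding preserves_relation_def
  proof (intro ballI impI)
    fix x assume x: "x \<in> {..<k} \<rightarrow> Hom ?B M"
      and xR: "\<forall>b\<in>carrier ?B. (\<lambda>i\<in>{..<k}. x i b) \<in> R"
    have k: "k \<ge> 1" using R by (simp add: compatible_relation_def)
    let ?y = "\<lambda>i. \<lambda>a\<in>carrier A. if a \<in> B then x i a else m0"
    have xH: "x i \<in> Hom ?B M" if "i < k" for i using x that by blast
    have xM: "x i b \<in> carrier M" if "i < k" "b \<in> B" for i b
      using HomD(2)[OF xH] that by simp
    have xm: "x i (a \<cdot>\<^bsub>A\<^esub> b) = x i a \<cdot>\<^bsub>M\<^esub> x i b" if "i < k" "a \<in> B" "b \<in> B" for i a b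
      using HomD(3)[OF xH] that by simp
    have "?y \<in> {..<k} \<rightarrow> ?P" using xM m0 by auto
    moreover have "\<forall>i<k. \<forall>a\<in>H k. \<forall>b\<in>H k. a \<cdot>\<^bsub>A\<^esub> b \<in> H k \<longrightarrow>
        ?y i (a \<cdot>\<^bsub>A\<^esub> b) = ?y i a \<cdot>\<^bsub>M\<^esub> ?y i b"
      using HB[OF k] BA xm by (auto simp: subset_iff)
    ultimately have "\<exists>c\<in>H k. \<forall>i<k. g (?y i) = ?y i c"
      by (rule bspec[OF H[OF k, THEN conjunct2, THEN conjunct2], THEN mp])
    then obtain c where c: "c \<in> H k" "\<forall>i<k. g (?y i) = ?y i c" by (elim bexE)
    have cB: "c \<in> B" using c HB[OF k] by blast
    have "g (x i) = x i c" if "i < k" for i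
    proof -
      have "g (x i) = g (?y i)" using FB F(2) by (intro g_det) auto
      then show ?thesis using c that cB BA by auto
    qed
    then have "(\<lambda>i\<in>{..<k}. g (x i)) = (\<lambda>i\<in>{..<k}. x i c)" by auto
    then show "(\<lambda>i\<in>{..<k}. g (x i)) \<in> R" using xR cB by simp
  qed
  moreover have "\<not> is_evaluation M ?B g"
  proof
    assume "is_evaluation M ?B g"
    then obtain b where b: "b \<in> B" "\<And>x. x \<in> Hom ?B M \<Longrightarrow> g x = x b"
      by (auto simp: is_evaluation_def)
    have "f x = x b" if x: "x \<in> Hom A M" for x
    proof -
      have "restrict x B \<in> Hom ?B M"
        using x BA Bc by (auto simp: Hom_def subset_iff PiE_mem)
      then have "g (restrict x B) = x b" using b by simp
      moreover have "g (restrict x B) = f x" using x FB by (intro g_f) auto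
      ultimately show ?thesis by simp
    qed
    then show False using noev b(1) BA by (auto simp: is_evaluation_def)
  qed
  ultimately have nd: "\<not> dualizes M ?B" unfolding dualizes_def by blast
  define h where "h = to_nat_on B"
  have inj: "inj_on h B" unfolding h_def by (rule inj_on_to_nat_on[OF B(2)])
  define N :: "nat magma" where
    "N = \<lparr>carrier = h ` B, mul = (\<lambda>m n. h (inv_into B h m \<cdot>\<^bsub>A\<^esub> inv_into B h n))\<rparr>"
  have iso: "isomorphism h ?B N"
    using inj by (auto simp: isomorphism_def N_def bij_betw_def)
  have algN: "is_algebra N"
    using inj Bc a0B by (auto simp: is_algebra_def N_def)
  have "in_ISP M N"
    by (rule isomorphic_in_ISP[OF isomorphism_inverse[OF iso algB algN] algN ISPB])
  then have "dualizes M N" using dual by (simp add: dualizable_def)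
  then have "dualizes M ?B" by (rule isomorphic_dualizes[OF fin iso algB algN])
  with nd show False ..
qed

end

theory Submission
  imports Defs
begin

text \<open>
  The proof exhibits a subalgebra \<open>A\<close> of an infinite power of \<open>M\<close> together with a sequence
  \<open>e\<close> in \<open>A\<close> on which every homomorphism \<open>x : A \<rightarrow> M\<close> is constant up to boundedly many
  exceptions. The map sending \<open>x\<close> to this almost constant value is continuous, and it preserves
  all compatible relations because finitely many homomorphisms reach their values at a common
  \<open>e n\<close>. The only tuple at which it could be the evaluation is the coordinatewise limit of the
  sequence, the ghost element; if the ghost is missing from \<open>A\<close>, then \<open>M\<close> is not dualizable
  (\<open>ghost_element_not_dualizable\<close>).

  Since \<open>\<rho>\<^sub>b\<close> and \<open>\<rho>\<^sub>c\<close> differ, some state \<open>q0\<close> has \<open>q0 \<cdot> b \<noteq> q0 \<cdot> c\<close>. Let \<open>k\<close> be the least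
  positive exponent at which the \<open>k\<close>-th powers of \<open>b\<close> and \<open>c\<close> agree at \<open>q0\<close>; it is greater
  than 1 and divides the order of \<open>\<rho>\<^sub>b\<rho>\<^sub>c\<^sup>-\<^sup>1\<close>. The algebra \<open>A\<close> is generated by the constant
  tuple \<open>q0\<close> and the letter tuples \<open>letter S\<close> which have \<open>b\<close> on \<open>S\<close> and \<open>c\<close> elsewhere, where
  \<open>S\<close> is a set of 1 or \<open>k + 1\<close> natural numbers; one additional coordinate always carries \<open>b\<close>.
  The sequence is \<open>e n = q0 \<cdot> letter {n}\<close>, and its ghost is \<open>q0 \<cdot> b\<close> at the additional coordinate
  and \<open>q0 \<cdot> c\<close> at all others.

  The ghost is not in \<open>A\<close> (\<open>ghost_notin_universe\<close>): in a word leading from \<open>q0\<close> to it, every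
  number would lie in a multiple of \<open>k\<close> of the chosen sets. As all these sets have size 1 modulo
  \<open>k\<close>, the length of the word would be a multiple of \<open>k\<close>, and then the additional coordinate
  could not tell \<open>b\<close> from \<open>c\<close>.

  The homomorphisms are almost constant (\<open>hom_two_values\<close>) because of the absence of cosets.
  Words of commuting permutations that agree at one state agree on its whole component. If \<open>x\<close> took
  two different states as values on \<open>e\<close>, one of them infinitely often and the other at least \<open>k\<close>
  times, and if \<open>s\<close> and \<open>s'\<close> are the actions on the component of the images of corresponding
  \<open>letter {n}\<close>, then
  \<open>\<delta> = s' s\<^sup>-\<^sup>1\<close> would satisfy \<open>\<delta>\<^sup>k = 1\<close>, and the image of \<open>letter S\<close>, for \<open>S\<close> consisting
  of \<open>t\<close> indices of the second kind and \<open>k + 1 - t\<close> of the first, would act as \<open>\<delta>\<^sup>t s\<close>. So the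
  letters would fill the coset of \<open>s\<close> modulo the cyclic group of \<open>\<delta>\<close>, which is excluded.
\<close>

section \<open>Ghost elements\<close>

text \<open>The number \<open>N\<close> must not depend on \<open>x\<close>: it makes the almost constant value of \<open>x\<close> the
  majority value among the first \<open>2 * N + 1\<close> members of \<open>e\<close>, and thereby a continuous function
  of \<open>x\<close>. The value at the \<open>i\<close>-th projection is \<open>g i\<close>, so no tuple but \<open>g\<close> can be the point of
  evaluation.\<close>

lemma ghost_element_not_dualizable:
  fixes M :: "'a magma" and I :: "'i set" and e :: "nat \<Rightarrow> 'i \<Rightarrow> 'a"
  assumes finM: "finite (carrier M)" and algM: "is_algebra M"
    and sub: "subuniverse B (direct_power M I)"
    and e: "\<And>n. e n \<in> B"
    and bound: "\<And>x. x \<in> Hom ((direct_power M I)\<lparr>carrier := B\<rparr>) M \<Longrightarrow>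
        \<exists>v. finite {n. x (e n) \<noteq> v} \<and> card {n. x (e n) \<noteq> v} \<le> N"
    and g: "g \<in> extensional I" "g \<notin> B"
    and e_g: "\<And>i. i \<in> I \<Longrightarrow> finite {n. e n i \<noteq> g i}"
  shows "\<not> dualizable M"
proof
  assume dual: "dualizable M"
  let ?A = "(direct_power M I)\<lparr>carrier := B\<rparr>"
  have BP: "B \<subseteq> I \<rightarrow>\<^sub>E carrier M"
    and Bc: "\<And>a b. a \<in> B \<Longrightarrow> b \<in> B \<Longrightarrow> (\<lambda>i\<in>I. a i \<cdot>\<^bsub>M\<^esub> b i) \<in> B"
    using sub by (auto simp: subuniverse_def direct_power_def)
  have algA: "is_algebra ?A"
    using Bc e[of 0] by (auto simp: is_algebra_def direct_power_def)
  have "isomorphism id ?A ?A" by (simp add: isomorphism_def)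
  then have ISP: "in_ISP M ?A" by (rule in_ISP_if_embeds[OF algA sub])
  define f where "f x = (SOME v. finite {n. x (e n) \<noteq> v} \<and> card {n. x (e n) \<noteq> v} \<le> N)"
    for x :: "('i \<Rightarrow> 'a) \<Rightarrow> 'a"
  have f: "finite {n. x (e n) \<noteq> f x}" "card {n. x (e n) \<noteq> f x} \<le> N" if "x \<in> Hom ?A M" for x
    using someI_ex[OF bound[OF that]] by (simp_all add: f_def)
  have f_unique: "f x = v" if x: "x \<in> Hom ?A M" and v: "finite {n. x (e n) \<noteq> v}" for x v
  proof (rule ccontr)
    assume "f x \<noteq> v"
    then have "{n. x (e n) \<noteq> f x} \<union> {n. x (e n) \<noteq> v} = UNIV" by auto
    moreover have "finite ({n. x (e n) \<noteq> f x} \<union> {n. x (e n) \<noteq> v})" using f(1)[OF x] v by simp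
    ultimately show False by simp
  qed
  have f_attained: "\<exists>n. x (e n) = f x" if "x \<in> Hom ?A M" for x
    using ex_new_if_finite[OF infinite_UNIV_nat f(1)[OF that]] by simp
  have "f x = f y"
    if xy: "x \<in> Hom ?A M" "y \<in> Hom ?A M" "\<forall>a\<in>e ` {..<2 * N + 1}. x a = y a" for x y
  proof -
    \<comment> \<open>The exceptions for \<open>x\<close> and \<open>y\<close> together cannot cover \<open>2 * N + 1\<close> indices.\<close>
    let ?X = "{n. x (e n) \<noteq> f x} \<union> {n. y (e n) \<noteq> f y}"
    have "finite ?X" using f(1) xy by simp
    moreover have "card ?X \<le> 2 * N"
      using card_Un_le[of "{n. x (e n) \<noteq> f x}" "{n. y (e n) \<noteq> f y}"] f(2)[OF xy(1)] f(2)[OF xy(2)]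
      by linarith
    ultimately have "\<not> {..<2 * N + 1} \<subseteq> ?X" using card_mono[of ?X "{..<2 * N + 1}"] by auto
    then obtain n where "n < 2 * N + 1" "x (e n) = f x" "y (e n) = f y" by auto
    then show ?thesis using xy(3) by auto
  qed
  then have "\<forall>x\<in>Hom ?A M. \<forall>y\<in>Hom ?A M. (\<forall>a\<in>e ` {..<2 * N + 1}. x a = y a) \<longrightarrow> f x = f y"
    by blast
  moreover have "finite (e ` {..<2 * N + 1})" "e ` {..<2 * N + 1} \<subseteq> carrier ?A"
    using e by auto
  moreover have "f \<in> Hom ?A M \<rightarrow> carrier M"
  proof
    fix x assume x: "x \<in> Hom ?A M"
    then obtain n where "x (e n) = f x" using f_attained by blast
    then show "f x \<in> carrier M" using HomD(2)[OF x, of "e n"] e by simp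
  qed
  ultimately have cont: "continuous_map (Hom_topology ?A M) (discrete_topology (carrier M)) f"
    unfolding continuous_iff_finitely_determined[OF finM algA]
    by (intro conjI exI[of _ "e ` {..<2 * N + 1}"])
  have pres: "preserves_relation M ?A f k R" if "compatible_relation M k R" for k R
    unfolding preserves_relation_def
  proof (intro ballI impI)
    fix x assume x: "x \<in> {..<k} \<rightarrow> Hom ?A M"
      and xR: "\<forall>a\<in>carrier ?A. (\<lambda>i\<in>{..<k}. x i a) \<in> R"
    \<comment> \<open>Finitely many homomorphisms attain their values at a common \<open>e n\<close>.\<close>
    have "finite (\<Union>i<k. {n. x i (e n) \<noteq> f (x i)})" using x f(1) by auto
    then obtain n where "n \<notin> (\<Union>i<k. {n. x i (e n) \<noteq> f (x i)})"
      using infinite_UNIV_nat ex_new_if_finite by blast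
    then have "(\<lambda>i\<in>{..<k}. f (x i)) = (\<lambda>i\<in>{..<k}. x i (e n))" by auto
    then show "(\<lambda>i\<in>{..<k}. f (x i)) \<in> R" using xR e by simp
  qed
  have "is_evaluation M ?A f"
    using dualizable_imp_dualizes[OF finM algM dual ISP] cont pres by (simp add: dualizes_def)
  then obtain a where a: "a \<in> B" "\<And>x. x \<in> Hom ?A M \<Longrightarrow> f x = x a"
    by (auto simp: is_evaluation_def)
  have "a i = g i" if i: "i \<in> I" for i
  proof -
    let ?p = "\<lambda>h\<in>B. h i"
    have "a i \<in> carrier M" if "a \<in> B" for a using BP i that by blast
    then have p: "?p \<in> Hom ?A M" using Bc i by (simp add: Hom_def direct_power_def)
    have "f ?p = g i" using e e_g[OF i] by (intro f_unique[OF p]) simp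
    then show ?thesis using a p by simp
  qed
  moreover have "a \<in> extensional I" using a(1) BP by (auto simp: PiE_def)
  ultimately have "a = g" using g(1) by (auto intro: extensionalityI)
  then show False using a(1) g(2) by simp
qed

section \<open>Cosets of cyclic groups\<close>

text \<open>With \<open>d = s' s\<^sup>-\<^sup>1\<close> the last hypothesis says \<open>w = d\<^sup>t s\<close>, and \<open>d\<^sup>m = 1\<close>; so these elements
  \<open>w\<close> run through the coset of \<open>s\<close> modulo the cyclic group generated by \<open>d\<close>. The factor \<open>s\<^sup>m\<close> is
  kept on both sides to state the hypothesis without inverses, as an equation between two words.\<close>

lemma (in group) right_coset_of_powers:
  assumes carr: "s \<in> carrier G" "s' \<in> carrier G" and comm: "s \<otimes> s' = s' \<otimes> s"
    and pow: "s [^] m = s' [^] m" and ne: "s \<noteq> s'" and m: "m > (0 :: nat)"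
    and W: "\<And>t. t < m \<Longrightarrow> \<exists>w\<in>W. w \<in> carrier G \<and> s [^] m \<otimes> w = s' [^] t \<otimes> s [^] (m + 1 - t)"
  shows "\<exists>H. subgroup H G \<and> H \<noteq> {\<one>} \<and> card H dvd m \<and> (\<exists>K\<in>rcosets H. K \<subseteq> W)"
proof -
  define d where "d = s' \<otimes> inv s"
  have d: "d \<in> carrier G" using carr by (simp add: d_def)
  have "s \<otimes> d = s' \<otimes> s \<otimes> inv s" using carr by (simp add: d_def m_assoc flip: comm)
  then have sd: "s \<otimes> d = d \<otimes> s" using carr by (simp add: d_def m_assoc)
  have s': "s' = d \<otimes> s" using carr by (simp add: d_def m_assoc)
  have pow_s': "s' [^] t = d [^] t \<otimes> s [^] t" for t :: nat
    unfolding s' using sd carr d by (intro pow_mult_distrib) simp_all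
  have "d [^] m \<otimes> s [^] m = s [^] m" using pow_s'[of m] unfolding pow by (rule sym)
  then have dm: "d [^] m = \<one>" using carr d by simp
  then have od: "ord d dvd m" using d by (simp add: pow_eq_id)
  then have od0: "ord d \<noteq> 0" using m by auto
  let ?H = "generate G {d}"
  have H: "?H = {d [^] k | k. k \<in> (UNIV :: nat set)}"
    using generate_pow_nat[OF d od0] .
  have sub: "subgroup ?H G" using d by (intro generate_is_subgroup) simp
  have "?H #> s \<subseteq> W"
  proof
    fix h assume "h \<in> ?H #> s"
    then obtain k :: nat where k: "h = d [^] k \<otimes> s" by (auto simp: r_coset_def H)
    define t where "t = k mod m"
    have t: "t < m" using m by (simp add: t_def)
    have "d [^] k = (d [^] m) [^] (k div m) \<otimes> d [^] t"
      by (simp only: nat_pow_pow[OF d] nat_pow_mult[OF d] t_def mult_div_mod_eq)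
    then have "d [^] k = d [^] t" using d by (simp add: dm)
    then have ht: "h = d [^] t \<otimes> s" using k by simp
    obtain w where w: "w \<in> W" "w \<in> carrier G" "s [^] m \<otimes> w = s' [^] t \<otimes> s [^] (m + 1 - t)"
      using W[OF t] by blast
    have "s [^] m \<otimes> w = d [^] t \<otimes> (s [^] t \<otimes> s [^] (m + 1 - t))"
      using w(3) carr d by (simp add: pow_s' m_assoc)
    also have "s [^] t \<otimes> s [^] (m + 1 - t) = s [^] m \<otimes> s"
      using carr t by (simp add: nat_pow_mult Suc_diff_le flip: m_assoc)
    also have "d [^] t \<otimes> (s [^] m \<otimes> s) = s [^] m \<otimes> (d [^] t \<otimes> s)"
    proof -
      have "d [^] t \<otimes> s = s \<otimes> d [^] t" using group_commutes_pow[OF sd[symmetric] d carr(1)] .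
      from group_commutes_pow[OF this[symmetric]] have "s [^] m \<otimes> d [^] t = d [^] t \<otimes> s [^] m"
        using carr d by simp
      then show ?thesis using carr d by (simp flip: m_assoc)
    qed
    finally have "s [^] m \<otimes> w = s [^] m \<otimes> h" by (simp add: ht)
    then have "w = h" using w(2) carr d by (simp add: ht)
    then show "h \<in> W" using w(1) by simp
  qed
  moreover have "?H #> s \<in> rcosets ?H"
    using carr sub by (intro rcosetsI) (auto simp: subgroup_def)
  moreover have "?H \<noteq> {\<one>}"
  proof
    assume "?H = {\<one>}"
    then have "d = \<one>" using generate.incl[of d "{d}" G] by auto
    then show False using ne s' carr by simp
  qed
  moreover have "card ?H dvd m" using od generate_pow_card[OF d] by simp
  ultimately show ?thesis using sub by blast
qed

section \<open>Words over commuting letters\<close>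

locale commuting_automaton =
  fixes M :: "'a magma" and Q L :: "'a set" and z :: 'a
  assumes automatic: "automatic_algebra M Q L z"
    and finite_carrier: "finite (carrier M)"
    and closed: "q \<in> Q \<Longrightarrow> a \<in> L \<Longrightarrow> q \<cdot>\<^bsub>M\<^esub> a \<in> Q"
    and inj: "q \<in> Q \<Longrightarrow> r \<in> Q \<Longrightarrow> a \<in> L \<Longrightarrow> q \<cdot>\<^bsub>M\<^esub> a = r \<cdot>\<^bsub>M\<^esub> a \<Longrightarrow> q = r"
    and commute: "q \<in> Q \<Longrightarrow> a \<in> L \<Longrightarrow> b \<in> L \<Longrightarrow> q \<cdot>\<^bsub>M\<^esub> a \<cdot>\<^bsub>M\<^esub> b = q \<cdot>\<^bsub>M\<^esub> b \<cdot>\<^bsub>M\<^esub> a"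
begin

abbreviation run :: "'a \<Rightarrow> 'a list \<Rightarrow> 'a" where
  "run \<equiv> foldl (\<lambda>q a. q \<cdot>\<^bsub>M\<^esub> a)"

lemma run_closed: "q \<in> Q \<Longrightarrow> set w \<subseteq> L \<Longrightarrow> run q w \<in> Q"
  by (induction w arbitrary: q) (auto simp: closed)

lemma run_letter: "q \<in> Q \<Longrightarrow> a \<in> L \<Longrightarrow> set w \<subseteq> L \<Longrightarrow> run (q \<cdot>\<^bsub>M\<^esub> a) w = run q w \<cdot>\<^bsub>M\<^esub> a"
  by (induction w arbitrary: q) (auto simp: closed commute)

lemma run_commute:
  "q \<in> Q \<Longrightarrow> set v \<subseteq> L \<Longrightarrow> set w \<subseteq> L \<Longrightarrow> run (run q v) w = run (run q w) v"
  by (induction v arbitrary: q) (auto simp: closed run_letter run_closed)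

lemma run_inj: "q \<in> Q \<Longrightarrow> r \<in> Q \<Longrightarrow> set w \<subseteq> L \<Longrightarrow> run q w = run r w \<Longrightarrow> q = r"
  by (induction w arbitrary: q r) (simp, metis closed foldl_Cons inj insert_subset list.simps(15))

definition component :: "'a \<Rightarrow> 'a set" where
  "component p = (component_graph M Q L)\<^sup>* `` {p}"

lemma component_in_components: "p \<in> Q \<Longrightarrow> component p \<in> automaton_components M Q L"
  by (auto simp: component_def automaton_components_def intro: quotientI)

lemma component_refl: "p \<in> component p"
  by (simp add: component_def)

lemma component_subset: "p \<in> Q \<Longrightarrow> component p \<subseteq> Q"
  by (auto simp: component_def component_graph_def elim: rtranclE)

lemma component_closed: "p \<in> Q \<Longrightarrow> q \<in> component p \<Longrightarrow> a \<in> L \<Longrightarrow> q \<cdot>\<^bsub>M\<^esub> a \<in> component p"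
proof -
  assume "p \<in> Q" "q \<in> component p" "a \<in> L"
  moreover from this have "q \<in> Q" using component_subset by blast
  ultimately show ?thesis
    unfolding component_def component_graph_def
    by (auto intro!: closed elim!: rtrancl_into_rtrancl)
qed

text \<open>The action of a word is determined on a whole component by its value at one state, as it
  commutes with each letter and the letters act injectively.\<close>

lemma run_eq_on_component:
  assumes p: "p \<in> Q" and vw: "set v \<subseteq> L" "set w \<subseteq> L" "run p v = run p w"
    and q: "q \<in> component p"
  shows "run q v = run q w"
proof -
  have "(p, q) \<in> (component_graph M Q L)\<^sup>*" using q by (simp add: component_def)
  then show ?thesis
  proof (induction rule: rtrancl_induct)
    case (step q r)
    then obtain a where a: "q \<in> Q" "r \<in> Q" "a \<in> L" "q \<cdot>\<^bsub>M\<^esub> a = r \<or> r \<cdot>\<^bsub>M\<^esub> a = q"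
      by (auto simp: component_graph_def)
    from a(4) show ?case
    proof
      assume "q \<cdot>\<^bsub>M\<^esub> a = r"
      then show ?thesis using run_letter[OF a(1,3)] vw step.IH by metis
    next
      assume "r \<cdot>\<^bsub>M\<^esub> a = q"
      then have "run r v \<cdot>\<^bsub>M\<^esub> a = run r w \<cdot>\<^bsub>M\<^esub> a" using run_letter[OF a(2,3)] vw step.IH by metis
      then show ?thesis using inj run_closed a(2,3) vw by metis
    qed
  qed (fact vw(3))
qed

lemma component_run_closed:
  "p \<in> Q \<Longrightarrow> q \<in> component p \<Longrightarrow> set w \<subseteq> L \<Longrightarrow> run q w \<in> component p"
  by (induction w arbitrary: q) (auto simp: component_closed)

definition word_action :: "'a \<Rightarrow> 'a list \<Rightarrow> 'a \<Rightarrow> 'a" where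
  "word_action p w = (\<lambda>q\<in>component p. run q w)"

lemma word_action_letter: "word_action p [a] = action M (component p) a"
  by (simp add: word_action_def action_def)

lemma finite_Q: "finite Q"
  using automatic finite_carrier by (simp add: automatic_algebra_def)

lemma word_action_closed:
  assumes p: "p \<in> Q" and w: "set w \<subseteq> L"
  shows "word_action p w \<in> carrier (BijGroup (component p))"
proof -
  have fin: "finite (component p)" using component_subset[OF p] finite_Q by (rule finite_subset)
  have "inj_on (word_action p w) (component p)"
    using component_subset[OF p] run_inj w by (fastforce simp: inj_on_def word_action_def)
  moreover have "word_action p w ` component p \<subseteq> component p"
    using component_run_closed[OF p _ w] by (auto simp: word_action_def)
  ultimately have "bij_betw (word_action p w) (component p) (component p)"
    using endo_inj_surj[OF fin] by (simp add: bij_betw_def)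
  then show ?thesis by (simp add: BijGroup_def Bij_def word_action_def)
qed

lemma word_action_append:
  assumes p: "p \<in> Q" and vw: "set v \<subseteq> L" "set w \<subseteq> L"
  shows "word_action p w \<otimes>\<^bsub>BijGroup (component p)\<^esub> word_action p v = word_action p (v @ w)"
  using word_action_closed[OF p vw(1)] word_action_closed[OF p vw(2)] component_run_closed[OF p _ vw(1)]
  by (auto simp: BijGroup_def compose_def word_action_def fun_eq_iff)

lemma word_action_pow:
  assumes p: "p \<in> Q" and a: "a \<in> L"
  shows "word_action p [a] [^]\<^bsub>BijGroup (component p)\<^esub> (n::nat) = word_action p (replicate n a)"
proof (induction n)
  case 0
  then show ?case by (auto simp: BijGroup_def word_action_def)
next
  case (Suc n)
  interpret group "BijGroup (component p)" by (rule group_BijGroup)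
  have "word_action p ([a] @ replicate n a) = word_action p (replicate n a) \<otimes>\<^bsub>BijGroup (component p)\<^esub> word_action p [a]"
    using a by (intro word_action_append[OF p, symmetric]) auto
  then show ?case using Suc by simp
qed

lemma word_action_eqI:
  assumes "p \<in> Q" "set v \<subseteq> L" "set w \<subseteq> L" "run p v = run p w"
  shows "word_action p v = word_action p w"
  using run_eq_on_component[OF assms] by (auto simp: word_action_def)

text \<open>Equations between words at the single state \<open>p\<close> suffice to obtain a coset in the symmetric group
  of the component of \<open>p\<close>, since they extend to the component.\<close>

lemma coset_of_letter_actions:
  assumes p: "p \<in> Q" and aL: "a \<in> L" "a' \<in> L" and m: "m > (0::nat)"
    and ne: "p \<cdot>\<^bsub>M\<^esub> a \<noteq> p \<cdot>\<^bsub>M\<^esub> a'"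
    and pow: "run p (replicate m a) = run p (replicate m a')"
    and W: "\<And>t. t < m \<Longrightarrow>
      \<exists>l\<in>L. run p (l # replicate m a) = run p (replicate (m + 1 - t) a @ replicate t a')"
  shows "\<exists>H. subgroup H (BijGroup (component p)) \<and> H \<noteq> {\<one>\<^bsub>BijGroup (component p)\<^esub>} \<and> card H dvd m \<and>
    (\<exists>K\<in>rcosets\<^bsub>BijGroup (component p)\<^esub> H. K \<subseteq> {action M (component p) l | l. l \<in> L})"
proof -
  let ?\<alpha> = "word_action p"
  interpret group "BijGroup (component p)" by (rule group_BijGroup)
  note app = word_action_append[OF p]
  have rep: "set (replicate n l) \<subseteq> L" if "l \<in> L" for n l using that by auto
  show ?thesis
  proof (rule right_coset_of_powers[where s = "?\<alpha> [a]" and s' = "?\<alpha> [a']"])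
    show "?\<alpha> [a] \<in> carrier (BijGroup (component p))" "?\<alpha> [a'] \<in> carrier (BijGroup (component p))"
      using aL by (auto intro!: word_action_closed p)
    show "?\<alpha> [a] \<otimes>\<^bsub>BijGroup (component p)\<^esub> ?\<alpha> [a'] = ?\<alpha> [a'] \<otimes>\<^bsub>BijGroup (component p)\<^esub> ?\<alpha> [a]"
      using aL p by (simp add: app commute word_action_eqI)
    show "?\<alpha> [a] [^]\<^bsub>BijGroup (component p)\<^esub> m = ?\<alpha> [a'] [^]\<^bsub>BijGroup (component p)\<^esub> m"
      unfolding word_action_pow[OF p aL(1)] word_action_pow[OF p aL(2)]
      using rep aL by (intro word_action_eqI p pow)
    have "?\<alpha> [a] p \<noteq> ?\<alpha> [a'] p" using ne by (simp add: word_action_def component_refl)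
    then show "?\<alpha> [a] \<noteq> ?\<alpha> [a']" by metis
    show "m > 0" by (fact m)
  next
    fix t assume "t < m"
    then obtain l where l: "l \<in> L"
      "run p (l # replicate m a) = run p (replicate (m + 1 - t) a @ replicate t a')"
      using W by blast
    have "?\<alpha> ([l] @ replicate m a) = ?\<alpha> (replicate (m + 1 - t) a @ replicate t a')"
      using l aL by (intro word_action_eqI p) auto
    then have "?\<alpha> [a] [^]\<^bsub>BijGroup (component p)\<^esub> m \<otimes>\<^bsub>BijGroup (component p)\<^esub> ?\<alpha> [l] =
      ?\<alpha> [a'] [^]\<^bsub>BijGroup (component p)\<^esub> t \<otimes>\<^bsub>BijGroup (component p)\<^esub> ?\<alpha> [a] [^]\<^bsub>BijGroup (component p)\<^esub> (m + 1 - t)"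
      unfolding word_action_pow[OF p aL(1)] word_action_pow[OF p aL(2)]
      using rep aL l by (simp only: app set_simps empty_subsetI insert_subset simp_thms)
    moreover have "?\<alpha> [l] \<in> carrier (BijGroup (component p))"
      using l by (intro word_action_closed p) auto
    ultimately show "\<exists>w\<in>{action M (component p) l | l. l \<in> L}. w \<in> carrier (BijGroup (component p)) \<and>
      ?\<alpha> [a] [^]\<^bsub>BijGroup (component p)\<^esub> m \<otimes>\<^bsub>BijGroup (component p)\<^esub> w =
      ?\<alpha> [a'] [^]\<^bsub>BijGroup (component p)\<^esub> t \<otimes>\<^bsub>BijGroup (component p)\<^esub> ?\<alpha> [a] [^]\<^bsub>BijGroup (component p)\<^esub> (m + 1 - t)"
      using l(1) by (intro bexI[of _ "?\<alpha> [l]"]) (auto simp: word_action_letter)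
  qed
qed

end

section \<open>Powers of two letters\<close>

context commuting_automaton
begin

lemma run_eq_if_same_letters:
  assumes p: "p \<in> Q" and a: "a \<in> L" and f: "\<And>j. j \<in> set js \<Longrightarrow> f j \<in> L \<and> p \<cdot>\<^bsub>M\<^esub> f j = p \<cdot>\<^bsub>M\<^esub> a"
    and q: "q \<in> component p"
  shows "run q (map f js) = run q (replicate (length js) a)"
  using f q
proof (induction js arbitrary: q)
  case (Cons j js)
  have f: "f j \<in> L" "p \<cdot>\<^bsub>M\<^esub> f j = p \<cdot>\<^bsub>M\<^esub> a" using Cons.prems(1)[of j] by simp_all
  have "run q [f j] = run q [a]"
    by (rule run_eq_on_component[OF p _ _ _ Cons.prems(2)]) (simp_all add: f a)
  then have "run q (map f (j # js)) = run (q \<cdot>\<^bsub>M\<^esub> a) (map f js)" by simp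
  also have "\<dots> = run (q \<cdot>\<^bsub>M\<^esub> a) (replicate (length js) a)"
    by (rule Cons.IH[OF _ component_closed[OF p Cons.prems(2) a]]) (rule Cons.prems(1), simp)
  finally show ?case by simp
qed simp

lemma set_replicate_subset: "a \<in> A \<Longrightarrow> set (replicate n a) \<subseteq> A"
  by auto

lemma run_two_letters:
  assumes "q \<in> Q" "b \<in> L" "c \<in> L"
  shows "run q (map (\<lambda>x. if P x then b else c) xs) =
    run (run q (replicate (length (filter P xs)) b)) (replicate (length (filter (\<lambda>x. \<not> P x) xs)) c)"
  using assms
proof (induction xs arbitrary: q)
  case (Cons x xs)
  have "set (replicate n c) \<subseteq> L" "set (replicate n b) \<subseteq> L" for n using Cons.prems by auto
  then show ?case using Cons by (simp add: closed run_letter run_closed)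
qed simp

lemma run_replicate_add:
  "run q (replicate (i + j) a) = run (run q (replicate i a)) (replicate j a)"
  by (simp add: replicate_add)

text \<open>Together with the trivial exponent 0 this makes the exponents at which \<open>b\<close> and \<open>c\<close> agree at
  \<open>q\<close> closed under sums and differences, so that they are the multiples of the least positive one
  (\<open>relative_period\<close>).\<close>

lemma equal_powers_diff:
  assumes q: "q \<in> Q" "b \<in> L" "c \<in> L"
    and i: "run q (replicate i b) = run q (replicate i c)"
  shows "run q (replicate (i + j) b) = run q (replicate (i + j) c) \<longleftrightarrow>
    run q (replicate j b) = run q (replicate j c)"
proof -
  have L: "set (replicate n b) \<subseteq> L" "set (replicate n c) \<subseteq> L" for n using q by auto
  have "run q (replicate (i + j) b) = run (run q (replicate j b)) (replicate i c)"
    unfolding run_replicate_add i by (intro run_commute q L)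
  moreover have "run q (replicate (i + j) c) = run (run q (replicate j c)) (replicate i c)"
    unfolding run_replicate_add by (intro run_commute q L)
  moreover have "run (run q (replicate j b)) (replicate i c) = run (run q (replicate j c)) (replicate i c)
      \<longleftrightarrow> run q (replicate j b) = run q (replicate j c)"
    by (rule iffI, erule run_inj[OF run_closed[OF q(1) L(1)] run_closed[OF q(1) L(2)] L(2)]) simp
  ultimately show ?thesis by (simp only:)
qed

lemma relative_period:
  assumes q: "q \<in> Q" "b \<in> L" "c \<in> L"
    and n: "n > 0" "run q (replicate n b) = run q (replicate n c)"
  obtains m where "m > 0"
    "\<And>k. run q (replicate k b) = run q (replicate k c) \<longleftrightarrow> m dvd k"
proof -
  let ?E = "\<lambda>k. run q (replicate k b) = run q (replicate k c)"
  define m where "m = (LEAST k. k > 0 \<and> ?E k)"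
  have m: "m > 0 \<and> ?E m" unfolding m_def by (rule LeastI[of _ n]) (use n in simp)
  have least: "\<not> ?E k" if "0 < k" "k < m" for k
    using not_less_Least[of k "\<lambda>k. k > 0 \<and> ?E k"] that by (auto simp: m_def)
  have "?E k \<longleftrightarrow> m dvd k" for k
  proof (induction k rule: less_induct)
    case (less k)
    consider "k = 0" | "0 < k" "k < m" | "m \<le> k" by linarith
    then show ?case
    proof cases
      case 2
      then show ?thesis using least by (auto dest: dvd_imp_le)
    next
      case 3
      then have "?E k \<longleftrightarrow> ?E (k - m)" using equal_powers_diff[OF q, of m "k - m"] m by simp
      then show ?thesis using less.IH[of "k - m"] 3 m by (simp add: dvd_minus_self)
    qed simp
  qed
  with m show ?thesis using that by blast
qed

end

section \<open>A subalgebra of a power that omits a ghost element\<close>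

locale ghost_construction = commuting_automaton +
  fixes b c q0 :: 'a and m :: nat
  assumes bc: "b \<in> L" "c \<in> L" and q0: "q0 \<in> Q" and m: "m > 1"
    and period: "\<And>n. foldl (\<lambda>q a. q \<cdot>\<^bsub>M\<^esub> a) q0 (replicate n b) = foldl (\<lambda>q a. q \<cdot>\<^bsub>M\<^esub> a) q0 (replicate n c) \<longleftrightarrow> m dvd n"
    and no_coset: "\<And>C H. C \<in> automaton_components M Q L \<Longrightarrow> subgroup H (BijGroup C) \<Longrightarrow>
      H \<noteq> {\<one>\<^bsub>BijGroup C\<^esub>} \<Longrightarrow> card H dvd m \<Longrightarrow>
      \<not> (\<exists>K\<in>rcosets\<^bsub>BijGroup C\<^esub> H. K \<subseteq> {action M C a | a. a \<in> L})"
begin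

lemma b_c_differ: "q0 \<cdot>\<^bsub>M\<^esub> b \<noteq> q0 \<cdot>\<^bsub>M\<^esub> c"
  using period[of 1] m by simp

text \<open>Sizes congruent to 1 modulo \<open>m\<close> keep the ghost out of the algebra; size \<open>m + 1\<close> is large enough
  to mix any number \<open>t < m\<close> of indices of one kind with indices of another.\<close>

definition supports :: "nat set set" where
  "supports = {S. finite S \<and> (card S = 1 \<or> card S = m + 1)}"

text \<open>The coordinate \<open>None\<close> counts the letters of a word: its entry in \<open>state w\<close> depends only on the
  length of \<open>w\<close>.\<close>

definition letter :: "nat set \<Rightarrow> nat option \<Rightarrow> 'a" where
  "letter S i = (case i of None \<Rightarrow> b | Some j \<Rightarrow> if j \<in> S then b else c)"

definition state :: "nat set list \<Rightarrow> nat option \<Rightarrow> 'a" where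
  "state w i = run q0 (map (\<lambda>S. letter S i) w)"

definition universe :: "(nat option \<Rightarrow> 'a) set" where
  "universe = letter ` supports \<union> state ` lists supports \<union> {\<lambda>_. z}"

abbreviation ghost_algebra :: "(nat option \<Rightarrow> 'a) magma" where
  "ghost_algebra \<equiv> (direct_power M UNIV)\<lparr>carrier := universe\<rparr>"

definition ghost :: "nat option \<Rightarrow> 'a" where
  "ghost i = (case i of None \<Rightarrow> q0 \<cdot>\<^bsub>M\<^esub> b | Some _ \<Rightarrow> q0 \<cdot>\<^bsub>M\<^esub> c)"

lemma Q_disjoint: "q \<in> Q \<Longrightarrow> q \<notin> L \<and> q \<noteq> z"
  using automatic by (auto simp: automatic_algebra_def)

lemma L_disjoint: "q \<in> L \<Longrightarrow> q \<notin> Q \<and> q \<noteq> z"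
  using automatic by (auto simp: automatic_algebra_def)

lemma carrier_M: "carrier M = Q \<union> L \<union> {z}"
  using automatic by (auto simp: automatic_algebra_def)

lemma mul_zero:
  "x \<in> carrier M \<Longrightarrow> y \<in> carrier M \<Longrightarrow> \<not> (x \<in> Q \<and> y \<in> L) \<Longrightarrow> x \<cdot>\<^bsub>M\<^esub> y = z"
  using automatic by (simp add: automatic_algebra_def)

lemma letter_in: "letter S i \<in> L"
  using bc by (simp add: letter_def split: option.split)

lemma state_in: "state w i \<in> Q"
  using letter_in by (auto simp: state_def intro!: run_closed q0)

lemma state_letter: "state w i \<cdot>\<^bsub>M\<^esub> letter S i = state (w @ [S]) i"
  by (simp add: state_def)

lemma singleton_support: "{n} \<in> supports"
  by (simp add: supports_def)

lemma mul_ghost_algebra: "x \<cdot>\<^bsub>ghost_algebra\<^esub> y = (\<lambda>i. x i \<cdot>\<^bsub>M\<^esub> y i)"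
  by (simp add: direct_power_def restrict_UNIV)

lemma universe_subuniverse: "subuniverse universe (direct_power M UNIV)"
proof -
  have car: "x i \<in> carrier M" if "x \<in> universe" for x i
    using that state_in letter_in by (auto simp: universe_def carrier_M)
  have "(\<lambda>i. x i \<cdot>\<^bsub>M\<^esub> y i) \<in> universe" if xy: "x \<in> universe" "y \<in> universe" for x y
  proof (cases "x \<in> state ` lists supports \<and> y \<in> letter ` supports")
    case True
    then obtain w S where "w \<in> lists supports" "x = state w" "S \<in> supports" "y = letter S" by blast
    then have "(\<lambda>i. x i \<cdot>\<^bsub>M\<^esub> y i) = state (w @ [S])" "w @ [S] \<in> lists supports"
      by (auto simp: state_letter)
    then show ?thesis unfolding universe_def by blast
  next
    case False
    then have "(\<forall>i. x i \<notin> Q) \<or> (\<forall>i. y i \<notin> L)"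
      using xy Q_disjoint L_disjoint state_in letter_in by (auto simp: universe_def)
    then have "(\<lambda>i. x i \<cdot>\<^bsub>M\<^esub> y i) = (\<lambda>_. z)" using car xy by (auto intro!: mul_zero)
    then show ?thesis by (simp add: universe_def)
  qed
  then show ?thesis using car by (auto simp: subuniverse_def direct_power_def PiE_UNIV_domain restrict_UNIV)
qed

text \<open>Double counting of the pairs of a number and a set of \<open>w\<close> containing it: if \<open>ghost = state w\<close>,
  then \<open>m\<close> divides the contribution of each number, while each set contributes 1 modulo \<open>m\<close>. Hence
  \<open>m\<close> divides the length of \<open>w\<close>, against the difference between the entry at \<open>None\<close> and the
  other ones.\<close>

lemma ghost_notin_universe: "ghost \<notin> universe"
proof
  assume "ghost \<in> universe"
  moreover have "ghost None \<in> Q" by (simp add: ghost_def closed q0 bc)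
  ultimately obtain w where w: "set w \<subseteq> supports" "ghost = state w"
    using letter_in L_disjoint Q_disjoint by (force simp: universe_def lists_eq_set)
  let ?k = "length w" and ?n = "\<lambda>j. length (filter (\<lambda>S. j \<in> S) w)"
  have L: "set (replicate n b) \<subseteq> L" "set (replicate n c) \<subseteq> L" for n using bc by auto
  have at: "run (run q0 (replicate (?n j) b)) (replicate (length (filter (\<lambda>S. j \<notin> S) w)) c) = q0 \<cdot>\<^bsub>M\<^esub> c" for j
    using fun_cong[OF w(2), of "Some j"]
    by (simp add: ghost_def state_def letter_def run_two_letters[OF q0 bc])
  have at_None: "run q0 (replicate ?k b) = q0 \<cdot>\<^bsub>M\<^esub> b"
    using fun_cong[OF w(2), of None]
    by (simp add: ghost_def state_def letter_def map_replicate_const)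
  have fin: "finite (\<Union>(set w))" using w(1) by (auto simp: supports_def)
  \<comment> \<open>A coordinate outside all sets of \<open>w\<close> reads the word as a power of \<open>c\<close>.\<close>
  then obtain j0 where "j0 \<notin> \<Union>(set w)" using infinite_UNIV_nat ex_new_if_finite by blast
  then have "filter (\<lambda>S. j0 \<in> S) w = []" "filter (\<lambda>S. j0 \<notin> S) w = w"
    by (auto simp: filter_empty_conv filter_id_conv)
  then have at_c: "run q0 (replicate ?k c) = q0 \<cdot>\<^bsub>M\<^esub> c" using at[of j0] by simp
  have dvd_n: "m dvd ?n j" for j
  proof -
    let ?r = "length (filter (\<lambda>S. j \<notin> S) w)"
    have "run q0 (replicate ?k c) = run (run q0 (replicate (?n j) c)) (replicate ?r c)"
      by (simp only: run_replicate_add[symmetric] sum_length_filter_compl)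
    then have "run q0 (replicate (?n j) b) = run q0 (replicate (?n j) c)"
      using at[of j] at_c run_inj[OF run_closed[OF q0 L(1)] run_closed[OF q0 L(2)] L(2)] by metis
    then show ?thesis by (simp add: period)
  qed
  have count: "(\<Sum>j\<in>U. length (filter (\<lambda>S. j \<in> S) v)) = sum_list (map card v)"
    if "finite U" "\<Union>(set v) \<subseteq> U" for U :: "nat set" and v
    using that
  proof (induction v)
    case (Cons S v)
    have "(\<Sum>j\<in>U. if j \<in> S then 1 else 0) = card S"
      using Cons.prems by (simp add: sum.If_cases Int_absorb1)
    moreover have "(\<Sum>j\<in>U. length (filter (\<lambda>S. j \<in> S) (S # v))) =
      (\<Sum>j\<in>U. (if j \<in> S then 1 else 0) + length (filter (\<lambda>S. j \<in> S) v))"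
      by (intro sum.cong) auto
    ultimately show ?case using Cons by (simp add: sum.distrib)
  qed simp
  have "\<exists>r. sum_list (map card v) = length v + m * r" if "set v \<subseteq> supports" for v
    using that
  proof (induction v)
    case (Cons S v)
    then obtain r where "sum_list (map card v) = length v + m * r" by auto
    moreover have "card S = 1 \<or> card S = m + 1" using Cons.prems by (simp add: supports_def)
    ultimately have "sum_list (map card (S # v)) = length (S # v) + m * r \<or>
      sum_list (map card (S # v)) = length (S # v) + m * Suc r" by auto
    then show ?case by blast
  qed simp
  then obtain r where "sum_list (map card w) = ?k + m * r" using w(1) by blast
  moreover have "m dvd sum_list (map card w)"
    using count[OF fin order_refl] dvd_n by (metis dvd_sum)
  ultimately have "m dvd ?k" by (metis dvd_add_left_iff dvd_triv_left)
  then have "run q0 (replicate ?k b) = run q0 (replicate ?k c)" by (simp add: period)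
  then show False using at_None at_c b_c_differ by simp
qed

text \<open>This relation and \<open>state_split_support\<close> are the only relations of the algebra that the analysis
  of homomorphisms uses; both hold because the \<open>m\<close>-th powers of \<open>b\<close> and \<open>c\<close> agree at \<open>q0\<close>.\<close>

lemma state_singleton_power: "state (replicate m {j}) = state (replicate m {k})"
proof
  fix i show "state (replicate m {j}) i = state (replicate m {k}) i"
    using period[of m] by (auto simp: state_def letter_def split: option.split)
qed

text \<open>A letter with a large support is the product of the letters of its elements, up to an \<open>m\<close>-th power
  that makes the two words equally long, as the coordinate \<open>None\<close> requires.\<close>

lemma state_split_support:
  assumes js: "distinct js" "length js = m + 1"
  shows "state (set js # replicate m {k}) = state (map (\<lambda>j. {j}) js)"
proof
  fix i
  have bm: "run q0 (replicate m b) = run q0 (replicate m c)" by (simp add: period)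
  show "state (set js # replicate m {k}) i = state (map (\<lambda>j. {j}) js) i"
  proof (cases i)
    case None
    then show ?thesis by (simp add: state_def letter_def map_replicate_const js comp_def)
  next
    case (Some l)
    let ?a = "if l \<in> set js then b else c"
    have a: "?a \<in> L" using bc by simp
    have "state (set js # replicate m {k}) i = run (q0 \<cdot>\<^bsub>M\<^esub> ?a) (replicate m (if l = k then b else c))"
      by (simp add: state_def letter_def Some)
    also have "\<dots> = run q0 (replicate m (if l = k then b else c)) \<cdot>\<^bsub>M\<^esub> ?a"
      using bc by (intro run_letter q0 a set_replicate_subset) simp
    also have "\<dots> = run q0 (replicate m c) \<cdot>\<^bsub>M\<^esub> ?a" by (cases "l = k") (simp_all only: bm if_True if_False refl)
    also have "\<dots> = run (q0 \<cdot>\<^bsub>M\<^esub> ?a) (replicate m c)" by (intro run_letter[symmetric] q0 a set_replicate_subset bc)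
    also have "\<dots> = run (run q0 (replicate (length (filter (\<lambda>j. l = j) js)) b))
      (replicate (length (filter (\<lambda>j. l \<noteq> j) js)) c)"
    proof -
      have one: "length (filter (\<lambda>j. l = j) js) = (if l \<in> set js then 1 else 0)"
        using js(1) by (induction js) auto
      have "length (filter (\<lambda>j. l = j) js) + length (filter (\<lambda>j. l \<noteq> j) js) = m + 1"
        using sum_length_filter_compl[of "\<lambda>j. l = j" js] js(2) by simp
      then have other: "length (filter (\<lambda>j. l \<noteq> j) js) = (if l \<in> set js then m else m + 1)"
        unfolding one by (simp split: if_splits)
      show ?thesis unfolding one other by simp
    qed
    also have "\<dots> = state (map (\<lambda>j. {j}) js) i"
      by (simp add: state_def letter_def Some comp_def run_two_letters[OF q0 bc])
    finally show ?thesis .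
  qed
qed

lemma state_universe: "set w \<subseteq> supports \<Longrightarrow> state w \<in> universe"
  by (auto simp: universe_def)

lemma letter_universe: "S \<in> supports \<Longrightarrow> letter S \<in> universe"
  by (auto simp: universe_def)

lemma run_zero: "set v \<subseteq> carrier M \<Longrightarrow> run z v = z"
proof -
  have "z \<in> carrier M" "z \<notin> Q" using carrier_M Q_disjoint by auto
  then show "set v \<subseteq> carrier M \<Longrightarrow> run z v = z" by (induction v) (simp_all add: mul_zero)
qed

context
  fixes x :: "(nat option \<Rightarrow> 'a) \<Rightarrow> 'a"
  assumes x: "x \<in> Hom ghost_algebra M"
begin

lemma hom_carrier: "a \<in> universe \<Longrightarrow> x a \<in> carrier M"
  using HomD(2)[OF x] by simp

lemma hom_state:
  assumes "set w \<subseteq> supports"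
  shows "x (state w) = run (x (state [])) (map (\<lambda>S. x (letter S)) w)"
  using assms
proof (induction w rule: rev_induct)
  case (snoc S w)
  have "state (w @ [S]) = state w \<cdot>\<^bsub>ghost_algebra\<^esub> letter S"
    unfolding mul_ghost_algebra by (simp add: state_letter)
  then have "x (state (w @ [S])) = x (state w) \<cdot>\<^bsub>M\<^esub> x (letter S)"
    using HomD(3)[OF x, of "state w" "letter S"] snoc.prems
    by (simp add: state_universe letter_universe)
  then show ?case using snoc by simp
qed simp

lemma hom_state_singleton: "x (state [{n}]) = x (state []) \<cdot>\<^bsub>M\<^esub> x (letter {n})"
  by (subst hom_state) (simp_all add: singleton_support)

lemma hom_letter_power:
  "run (x (state [])) (replicate m (x (letter {j}))) = run (x (state [])) (replicate m (x (letter {k})))"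
proof -
  have "x (state (replicate m {j})) = x (state (replicate m {k}))"
    by (simp only: state_singleton_power[of j k])
  moreover have "x (state (replicate m {n})) = run (x (state [])) (replicate m (x (letter {n})))" for n
    by (subst hom_state) (auto simp: singleton_support)
  ultimately show ?thesis by simp
qed

text \<open>By \<open>state_singleton_power\<close>, if \<open>x\<close> sends one letter with a singleton support outside \<open>L\<close>, then
  the \<open>m\<close>-th power of every other one also annihilates \<open>x (state [])\<close>, although words over \<open>L\<close>
  never lead out of \<open>Q\<close>.\<close>

lemma hom_constant_if_letter_lost:
  assumes j: "x (letter {j}) \<notin> L"
  shows "x (state [{n}]) = z"
proof -
  let ?p = "x (state [])" and ?a = "\<lambda>n. x (letter {n})"
  have p: "?p \<in> carrier M" by (simp add: hom_carrier state_universe)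
  have a: "?a n \<in> carrier M" for n by (simp add: hom_carrier letter_universe singleton_support)
  obtain m' where m': "m = Suc m'" using m by (cases m) auto
  have "run ?p (replicate m (?a j)) = run (?p \<cdot>\<^bsub>M\<^esub> ?a j) (replicate m' (?a j))" by (simp add: m')
  also have "?p \<cdot>\<^bsub>M\<^esub> ?a j = z" using j by (intro mul_zero p a) simp
  also have "run z (replicate m' (?a j)) = z" using a by (intro run_zero) auto
  finally have "run ?p (replicate m (?a n)) = z"
    by (simp only: hom_letter_power[of n j])
  moreover have "z \<notin> Q" using Q_disjoint by blast
  ultimately have "run ?p (replicate m (?a n)) \<notin> Q" by simp
  then have "\<not> (?p \<in> Q \<and> ?a n \<in> L)" using run_closed[of ?p "replicate m (?a n)", OF _ set_replicate_subset] by blast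
  then have "?p \<cdot>\<^bsub>M\<^esub> ?a n = z" by (rule mul_zero[OF p a])
  then show ?thesis by (simp add: hom_state_singleton)
qed

text \<open>With \<open>m\<close> indices of value \<open>u'\<close> and sufficiently many of value \<open>u\<close>, every mixture of \<open>t\<close> and
  \<open>m + 1 - t\<close> of them is the support of a letter, whose image must be a letter by
  \<open>state_split_support\<close>. These images act on the component as a full coset of a cyclic group.\<close>

lemma hom_two_values:
  assumes p: "x (state []) \<in> Q" and a: "\<And>n. x (letter {n}) \<in> L"
    and u: "infinite {n. x (state [{n}]) = u}" and ne: "u' \<noteq> u"
  shows "finite {n. x (state [{n}]) = u'} \<and> card {n. x (state [{n}]) = u'} < m"
proof (rule ccontr)
  let ?p = "x (state [])" and ?a = "\<lambda>n. x (letter {n})"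
  let ?U = "{n. x (state [{n}]) = u}" and ?U' = "{n. x (state [{n}]) = u'}"
  assume "\<not> (finite ?U' \<and> card ?U' < m)"
  then have "\<exists>T. T \<subseteq> ?U' \<and> card T = m \<and> finite T"
  proof (cases "finite ?U'")
    case False
    from infinite_arbitrarily_large[OF this, of m] show ?thesis by (elim exE conjE) (intro exI conjI)
  next
    case True
    then have "m \<le> card ?U'" using \<open>\<not> (finite ?U' \<and> card ?U' < m)\<close> by simp
    then show ?thesis using obtain_subset_with_card_n[of m ?U'] by metis
  qed
  then obtain T where T: "T \<subseteq> ?U'" "card T = m" "finite T" by (elim exE conjE)
  have val: "?p \<cdot>\<^bsub>M\<^esub> ?a n = u" if "n \<in> ?U" for n
    using that by (simp add: hom_state_singleton)
  have val': "?p \<cdot>\<^bsub>M\<^esub> ?a n = u'" if "n \<in> T" for n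
    using that T(1) by (auto simp: hom_state_singleton subset_iff)
  obtain k where k: "k \<in> ?U" using infinite_imp_nonempty[OF u] by blast
  obtain k' where k': "k' \<in> T" using T(2) m by fastforce
  have "\<exists>H. subgroup H (BijGroup (component ?p)) \<and> H \<noteq> {\<one>\<^bsub>BijGroup (component ?p)\<^esub>} \<and> card H dvd m \<and>
    (\<exists>K\<in>rcosets\<^bsub>BijGroup (component ?p)\<^esub> H. K \<subseteq> {action M (component ?p) l | l. l \<in> L})"
  proof (rule coset_of_letter_actions[OF p a[of k] a[of k']])
    show "0 < m" using m by simp
    show "?p \<cdot>\<^bsub>M\<^esub> ?a k \<noteq> ?p \<cdot>\<^bsub>M\<^esub> ?a k'" using ne by (simp add: val[OF k] val'[OF k'])
    show "run ?p (replicate m (?a k)) = run ?p (replicate m (?a k'))"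
      by (rule hom_letter_power)
  next
    fix t assume t: "t < m"
    obtain Y where Y: "Y \<subseteq> T" "card Y = t" "finite Y"
      using obtain_subset_with_card_n[of t T] t T by auto
    obtain X where X: "X \<subseteq> ?U" "card X = m + 1 - t" "finite X"
      using infinite_arbitrarily_large[OF u] by blast
    obtain xs where xs: "set xs = X" "distinct xs" "length xs = m + 1 - t"
      using finite_distinct_list[OF X(3)] X(2) distinct_card by metis
    obtain ys where ys: "set ys = Y" "distinct ys" "length ys = t"
      using finite_distinct_list[OF Y(3)] Y(2) distinct_card by metis
    let ?js = "xs @ ys"
    have "X \<inter> Y = {}" using X Y T(1) ne by auto
    then have js: "distinct ?js" "length ?js = m + 1" using xs ys t by auto
    have S: "set ?js \<in> supports" using distinct_card[OF js(1)] js(2) by (simp add: supports_def)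
    let ?l = "x (letter (set ?js))"
    have "run ?p (?l # replicate m (?a k)) = x (state (set ?js # replicate m {k}))"
    proof -
      have "set (set ?js # replicate m {k}) \<subseteq> supports" using S singleton_support by auto
      from hom_state[OF this] show ?thesis by (simp del: set_append)
    qed
    also have "\<dots> = x (state (map (\<lambda>j. {j}) ?js))" by (simp only: state_split_support[OF js])
    also have "\<dots> = run ?p (map ?a ?js)"
    proof -
      have "set (map (\<lambda>j. {j}) ?js) \<subseteq> supports" using singleton_support by auto
      from hom_state[OF this] show ?thesis by (simp add: comp_def)
    qed
    finally have eq: "run ?p (?l # replicate m (?a k)) = run ?p (map ?a ?js)" .
    also have "\<dots> = run ?p (replicate (m + 1 - t) (?a k) @ replicate t (?a k'))"
    proof -
      have "run ?p (map ?a xs) = run ?p (replicate (length xs) (?a k))"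
        by (intro run_eq_if_same_letters[OF p a] component_refl)
            (simp add: a xs(1) val[OF k] val[OF subsetD[OF X(1)]])
      moreover have "run ?p (replicate (length xs) (?a k)) \<in> component ?p"
        using a by (intro component_run_closed[OF p] component_refl) auto
      moreover have "run r (map ?a ys) = run r (replicate (length ys) (?a k'))" if "r \<in> component ?p" for r
        by (intro run_eq_if_same_letters[OF p a] that)
            (simp add: a ys(1) val'[OF k'] val'[OF subsetD[OF Y(1)]])
      ultimately show ?thesis by (simp add: xs ys del: foldl_Cons)
    qed
    finally have eq': "run ?p (?l # replicate m (?a k)) =
      run ?p (replicate (m + 1 - t) (?a k) @ replicate t (?a k'))" .
    have "run ?p (map ?a ?js) \<in> Q" using a by (intro run_closed p) auto
    then have "run ?p (?l # replicate m (?a k)) \<noteq> z" unfolding eq by (rule Q_disjoint[THEN conjunct2])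
    moreover have "run ?p (?l # replicate m (?a k)) = z" if "?l \<notin> L"
    proof -
      have "?p \<cdot>\<^bsub>M\<^esub> ?l = z"
        using that S by (intro mul_zero hom_carrier state_universe letter_universe) simp_all
      moreover have "?a k \<in> carrier M" using a[of k] by (simp add: carrier_M)
      then have "run z (replicate m (?a k)) = z" by (intro run_zero set_replicate_subset)
      ultimately show ?thesis by simp
    qed
    \<comment> \<open>A non-letter in place of \<open>?l\<close> would send the whole word to \<open>z\<close>, outside of \<open>Q\<close>.\<close>
    ultimately have "?l \<in> L" by blast
    with eq' show "\<exists>l\<in>L. run ?p (l # replicate m (?a k)) =
      run ?p (replicate (m + 1 - t) (?a k) @ replicate t (?a k'))" by blast
  qed
  then show False using no_coset[OF component_in_components[OF p]] by blast
qed

lemma hom_almost_constant: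
  "\<exists>v. finite {n. x (state [{n}]) \<noteq> v} \<and> card {n. x (state [{n}]) \<noteq> v} \<le> card (carrier M) * m"
proof (cases "x (state []) \<in> Q \<and> (\<forall>n. x (letter {n}) \<in> L)")
  case True
  let ?e = "\<lambda>n. x (state [{n}])"
  have e: "?e n \<in> carrier M" for n by (simp add: hom_carrier state_universe singleton_support)
  have "range ?e \<subseteq> carrier M" by (rule image_subsetI) (rule e)
  then have "finite (range ?e)" using finite_carrier by (rule finite_subset)
  then obtain n0 where "infinite {n \<in> UNIV. ?e n = ?e n0}"
    using pigeonhole_infinite[OF infinite_UNIV_nat] by blast
  then have inf: "infinite {n. ?e n = ?e n0}" by simp
  have small: "finite {n. ?e n = v} \<and> card {n. ?e n = v} \<le> m" if "v \<noteq> ?e n0" for v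
    using hom_two_values[OF conjunct1[OF True] spec[OF conjunct2[OF True]] inf that]
    by (simp add: less_imp_le)
  let ?V = "carrier M - {?e n0}"
  have eq: "{n. ?e n \<noteq> ?e n0} = (\<Union>v\<in>?V. {n. ?e n = v})" by (simp add: set_eq_iff e)
  have finV: "finite ?V" using finite_carrier by simp
  have "card (\<Union>v\<in>?V. {n. ?e n = v}) \<le> (\<Sum>v\<in>?V. card {n. ?e n = v})"
    by (rule card_UN_le[OF finV])
  also have "\<dots> \<le> (\<Sum>v\<in>?V. m)" using small by (intro sum_mono) auto
  also have "\<dots> = card ?V * m" by simp
  also have "\<dots> \<le> card (carrier M) * m" by (intro mult_right_mono card_Diff1_le) simp
  finally have "card {n. ?e n \<noteq> ?e n0} \<le> card (carrier M) * m" unfolding eq .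
  moreover have "finite {n. ?e n \<noteq> ?e n0}" unfolding eq using finV small by auto
  ultimately show ?thesis by blast
next
  case False
  have "x (state [{n}]) = z" for n
  proof (cases "x (state []) \<in> Q")
    case True
    then show ?thesis using False hom_constant_if_letter_lost by blast
  next
    case no: False
    have "x (state []) \<cdot>\<^bsub>M\<^esub> x (letter {n}) = z"
      using no by (intro mul_zero hom_carrier) (auto simp: state_universe letter_universe singleton_support)
    then show ?thesis by (simp add: hom_state_singleton)
  qed
  then show ?thesis by (intro exI[of _ z]) simp
qed

end

lemma not_dualizable: "\<not> dualizable M"
proof (rule ghost_element_not_dualizable[OF finite_carrier _ universe_subuniverse])
  show "is_algebra M"
    unfolding is_algebra_def
  proof (intro conjI ballI)
    fix x y assume xy: "x \<in> carrier M" "y \<in> carrier M"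
    show "x \<cdot>\<^bsub>M\<^esub> y \<in> carrier M"
    proof (cases "x \<in> Q \<and> y \<in> L")
      case True
      then show ?thesis using closed[of x y] by (simp add: carrier_M)
    next
      case False
      from mul_zero[OF xy this] show ?thesis by (simp add: carrier_M)
    qed
  qed (simp add: carrier_M)
  show "state [{n}] \<in> universe" for n
    by (rule state_universe) (simp add: singleton_support)
  show "\<exists>v. finite {n. x (state [{n}]) \<noteq> v} \<and> card {n. x (state [{n}]) \<noteq> v} \<le> card (carrier M) * m"
    if "x \<in> Hom ghost_algebra M" for x
    using that by (rule hom_almost_constant)
  show "ghost \<in> extensional UNIV" by simp
  show "ghost \<notin> universe" by (rule ghost_notin_universe)
  show "finite {n. state [{n}] i \<noteq> ghost i}" for i
  proof (cases i)
    case (Some j)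
    then have "{n. state [{n}] i \<noteq> ghost i} \<subseteq> {j}"
      by (auto simp: state_def letter_def ghost_def)
    then show ?thesis using finite_subset by blast
  qed (simp add: state_def letter_def ghost_def)
qed

end

section \<open>Commuting permutations without cosets\<close>

theorem theorem7p2:
  fixes M :: "'a magma" and Q L :: "'a set" and z :: 'a and m :: nat
  assumes "automatic_algebra M Q L z"
    and "finite (carrier M)"
    and "m > 1"
    and "\<forall>a\<in>L. bij_betw (action M Q a) Q Q"
    and "\<forall>a\<in>L. \<forall>b\<in>L. action M Q a \<otimes>\<^bsub>BijGroup Q\<^esub> action M Q b
                       = action M Q b \<otimes>\<^bsub>BijGroup Q\<^esub> action M Q a"
    and "\<exists>b\<in>L. \<exists>c\<in>L. group.ord (BijGroup Q)
           (action M Q b \<otimes>\<^bsub>BijGroup Q\<^esub> inv\<^bsub>BijGroup Q\<^esub> (action M Q c)) = m"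
    and "\<forall>C\<in>automaton_components M Q L.
           \<not> (\<exists>H. subgroup H (BijGroup C) \<and> H \<noteq> {\<one>\<^bsub>BijGroup C\<^esub>} \<and> card H dvd m \<and>
                  (\<exists>K \<in> rcosets\<^bsub>BijGroup C\<^esub> H. K \<subseteq> {action M C a | a. a \<in> L}))"
  shows "\<not> dualizable M"
proof -
  interpret G: group "BijGroup Q" by (rule group_BijGroup)
  let ?\<alpha> = "action M Q"
  have carr: "?\<alpha> a \<in> carrier (BijGroup Q)" if "a \<in> L" for a
    using assms(4) that by (simp add: BijGroup_def Bij_def action_def)
  have mult: "(f \<otimes>\<^bsub>BijGroup Q\<^esub> g) q = f (g q)"
    if "f \<in> carrier (BijGroup Q)" "g \<in> carrier (BijGroup Q)" "q \<in> Q" for f g q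
    using that by (simp add: BijGroup_def compose_def)
  have closed: "q \<cdot>\<^bsub>M\<^esub> a \<in> Q" if "q \<in> Q" "a \<in> L" for q a
    using assms(4) that by (auto simp: bij_betw_def action_def)
  interpret commuting_automaton M Q L z
  proof
    show "q = r" if "q \<in> Q" "r \<in> Q" "a \<in> L" "q \<cdot>\<^bsub>M\<^esub> a = r \<cdot>\<^bsub>M\<^esub> a" for q r a
      using assms(4) that by (auto simp: bij_betw_def action_def inj_on_def)
    show "q \<cdot>\<^bsub>M\<^esub> a \<cdot>\<^bsub>M\<^esub> b = q \<cdot>\<^bsub>M\<^esub> b \<cdot>\<^bsub>M\<^esub> a" if "q \<in> Q" "a \<in> L" "b \<in> L" for q a b
    proof -
      have "(?\<alpha> b \<otimes>\<^bsub>BijGroup Q\<^esub> ?\<alpha> a) q = (?\<alpha> a \<otimes>\<^bsub>BijGroup Q\<^esub> ?\<alpha> b) q"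
        using assms(5)[rule_format, OF that(3,2)] by (rule arg_cong)
      then show ?thesis using that by (simp add: mult carr) (simp add: action_def closed)
    qed
  qed (fact assms closed)+
  obtain b c where bc: "b \<in> L" "c \<in> L"
    and ord: "G.ord (?\<alpha> b \<otimes>\<^bsub>BijGroup Q\<^esub> inv\<^bsub>BijGroup Q\<^esub> (?\<alpha> c)) = m"
    using assms(6) by blast
  have pow: "(?\<alpha> a [^]\<^bsub>BijGroup Q\<^esub> n) q = run q (replicate n a)" if "a \<in> L" "q \<in> Q" for a q and n :: nat
    using that(2)
  proof (induction n arbitrary: q)
    case 0
    then show ?case by (simp add: BijGroup_def)
  next
    case (Suc n)
    have "?\<alpha> a q = q \<cdot>\<^bsub>M\<^esub> a" using Suc.prems by (simp add: action_def)
    then show ?case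
      using Suc.IH[OF closed[OF Suc.prems that(1)]] Suc.prems that(1) by (simp add: mult carr)
  qed
  have "?\<alpha> b \<noteq> ?\<alpha> c"
  proof
    assume "?\<alpha> b = ?\<alpha> c"
    then have "G.ord \<one>\<^bsub>BijGroup Q\<^esub> = m" using ord carr bc by simp
    then show False using assms(3) by simp
  qed
  then obtain q0 where q0: "q0 \<in> Q" "q0 \<cdot>\<^bsub>M\<^esub> b \<noteq> q0 \<cdot>\<^bsub>M\<^esub> c"
    by (auto simp: action_def fun_eq_iff split: if_splits)
  have "run q0 (replicate m b) = run q0 (replicate m c)"
  proof -
    let ?d = "?\<alpha> b \<otimes>\<^bsub>BijGroup Q\<^esub> inv\<^bsub>BijGroup Q\<^esub> (?\<alpha> c)"
    have d: "?d \<in> carrier (BijGroup Q)" and b: "?\<alpha> b = ?d \<otimes>\<^bsub>BijGroup Q\<^esub> ?\<alpha> c"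
      using carr bc by (simp_all add: G.m_assoc)
    have "?\<alpha> c \<otimes>\<^bsub>BijGroup Q\<^esub> ?d = ?\<alpha> b \<otimes>\<^bsub>BijGroup Q\<^esub> ?\<alpha> c \<otimes>\<^bsub>BijGroup Q\<^esub> inv\<^bsub>BijGroup Q\<^esub> (?\<alpha> c)"
      using assms(5) carr bc by (simp add: G.m_assoc[symmetric])
    then have "?d \<otimes>\<^bsub>BijGroup Q\<^esub> ?\<alpha> c = ?\<alpha> c \<otimes>\<^bsub>BijGroup Q\<^esub> ?d"
      using carr bc by (simp add: G.m_assoc)
    then have "?\<alpha> b [^]\<^bsub>BijGroup Q\<^esub> m = ?d [^]\<^bsub>BijGroup Q\<^esub> m \<otimes>\<^bsub>BijGroup Q\<^esub> ?\<alpha> c [^]\<^bsub>BijGroup Q\<^esub> m"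
      using G.pow_mult_distrib[OF _ d carr[OF bc(2)], of m] by (simp only: b[symmetric])
    also have "?d [^]\<^bsub>BijGroup Q\<^esub> m = \<one>\<^bsub>BijGroup Q\<^esub>"
      using G.pow_ord_eq_1[OF d] ord by simp
    finally have "?\<alpha> b [^]\<^bsub>BijGroup Q\<^esub> m = ?\<alpha> c [^]\<^bsub>BijGroup Q\<^esub> m"
      using carr bc by simp
    then show ?thesis using pow[OF bc(1) q0(1), of m] pow[OF bc(2) q0(1), of m] by simp
  qed
  moreover have "m > 0" using assms(3) by simp
  ultimately obtain k where k: "k > 0"
    "\<And>n. run q0 (replicate n b) = run q0 (replicate n c) \<longleftrightarrow> k dvd n"
    using relative_period[OF q0(1) bc] by blast
  \<comment> \<open>Passing from \<open>m\<close> to its divisor \<open>k\<close> only shrinks the set of subgroups to be excluded.\<close>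
  have "k dvd m" using k(2) \<open>run q0 (replicate m b) = run q0 (replicate m c)\<close> by blast
  moreover have "k \<noteq> 1" using k(2)[of 1] q0(2) by auto
  ultimately interpret ghost_construction M Q L z b c q0 k
  proof unfold_locales
    fix C H
    assume "k dvd m" "C \<in> automaton_components M Q L" "subgroup H (BijGroup C)"
      "H \<noteq> {\<one>\<^bsub>BijGroup C\<^esub>}" "card H dvd k"
    then show "\<not> (\<exists>K\<in>rcosets\<^bsub>BijGroup C\<^esub> H. K \<subseteq> {action M C a | a. a \<in> L})"
      using assms(7) dvd_trans by blast
  qed (use bc q0 k in auto)
  show ?thesis by (rule not_dualizable)
qed

end
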